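(* Let $f:\mathcal{K}(\mathbb{C}^{n})\rightarrow \mathbb{C}^n$ be a continuous map which satisfies (i) $f(K+L)=f(K)+f(L)$ whenever $K,L\in\mathcal{K}(\mathbb{C}^n)$; and (ii) $f(gK)=g(f(K))$ whenever $g\in \overline{U(n)}$ and $K\in\mathcal{K}(\mathbb{C}^n)$. Then $f=s$, where $s$ is the Steiner point map.
   Context: $\mathcal{K}(\mathbb{C}^n)$ is the set of nonempty compact convex subsets of $\mathbb{C}^n\cong\mathbb{R}^{2n}$ with the Hausdorff metric, and $K+L$ is the Minkowski sum. $\overline{U(n)}=U(n)\ltimes\mathbb{C}^n$ is the group of unitary affine transformations $x\mapsto ax+b$, $a\in U(n)$, $b\in\mathbb{C}^n$. The Steiner point of $K\in\mathcal{K}(V)$, for a euclidean vector space $V$ of real dimension $m$, is $$s(K)=m\int_{S(V)}u\,h_K(u)\,du,$$ where $h_K(u)=\sup_{x\in K}\langle u,x\rangle$ is the support function and $du$ is the rotation-invariant probability measure on the unit sphere $S(V)$. Here $V=\mathbb{C}^n$, $m=2n$, and $\langle\cdot,\cdot\rangle$ is the real inner product. *)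

theory Defs
  imports "HOL-Probability.Probability"
begin

section \<open>Convex bodies and the Hausdorff metric\<close>

definition convex_bodies :: "'a::real_normed_vector set set" where
  "convex_bodies = {K. K \<noteq> {} \<and> compact K \<and> convex K}"

text \<open>The value on sets that are empty or unbounded is a dummy.\<close>

definition hausdorff_distance :: "'a::metric_space set \<Rightarrow> 'a set \<Rightarrow> real" where
  "hausdorff_distance K L =
     (if K \<noteq> {} \<and> L \<noteq> {} \<and> bounded K \<and> bounded L
      then max (SUP x\<in>K. infdist x L) (SUP y\<in>L. infdist y K) else 0)"

lemma bdd_above_infdist_image:
  fixes K L :: "'a::metric_space set"
  assumes "bounded K" "L \<noteq> {}"
  shows "bdd_above ((\<lambda>x. infdist x L) ` K)"
proof -
  obtain l where l: "l \<in> L" using assms by auto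
  obtain e where e: "\<And>x. x \<in> K \<Longrightarrow> dist l x \<le> e"
    using assms(1) bounded_any_center[of K l] by auto
  have "infdist x L \<le> e" if "x \<in> K" for x
    using infdist_le[OF l, of x] e[OF that] by (simp add: dist_commute)
  then show ?thesis by (intro bdd_aboveI2)
qed

lemma hausdorff_distance_le_iff:
  fixes K L :: "'a::metric_space set"
  assumes "K \<noteq> {}" "L \<noteq> {}" "bounded K" "bounded L"
  shows "hausdorff_distance K L \<le> r \<longleftrightarrow>
           (\<forall>x\<in>K. infdist x L \<le> r) \<and> (\<forall>y\<in>L. infdist y K \<le> r)"
  using assms
  by (simp add: hausdorff_distance_def cSUP_le_iff bdd_above_infdist_image)

lemma hausdorff_distance_nonneg: "0 \<le> hausdorff_distance K L"
proof (cases "K \<noteq> {} \<and> L \<noteq> {} \<and> bounded K \<and> bounded L")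
  case True
  then obtain x where "x \<in> K" by blast
  then have "infdist x L \<le> hausdorff_distance K L"
    using hausdorff_distance_le_iff[of K L "hausdorff_distance K L"] True by simp
  then show ?thesis
    using infdist_nonneg[of x L] by linarith
qed (auto simp: hausdorff_distance_def)

lemma hausdorff_distance_commute: "hausdorff_distance K L = hausdorff_distance L K"
  by (auto simp: hausdorff_distance_def max.commute)

lemma hausdorff_distance_triangle:
  fixes K L M :: "'a::metric_space set"
  assumes ne: "K \<noteq> {}" "L \<noteq> {}" "M \<noteq> {}" and bd: "bounded K" "bounded L" "bounded M"
  shows "hausdorff_distance K M \<le> hausdorff_distance K L + hausdorff_distance L M"
proof -
  have *: "infdist x C \<le> hausdorff_distance A B + hausdorff_distance B C"
    if ABC: "A \<noteq> {}" "B \<noteq> {}" "C \<noteq> {}" "bounded A" "bounded B" "bounded C" and x: "x \<in> A"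
    for x :: 'a and A B C
  proof -
    have AB: "infdist x B \<le> hausdorff_distance A B"
      using hausdorff_distance_le_iff[of A B "hausdorff_distance A B"] ABC x by auto
    have BC: "infdist b C \<le> hausdorff_distance B C" if "b \<in> B" for b
      using hausdorff_distance_le_iff[of B C "hausdorff_distance B C"] ABC that by auto
    have "infdist x C - hausdorff_distance B C \<le> dist x b" if "b \<in> B" for b
      using infdist_triangle[of x C b] BC[OF that] by linarith
    then have "infdist x C - hausdorff_distance B C \<le> infdist x B"
      using ABC by (auto simp: infdist_def intro!: cINF_greatest)
    with AB show ?thesis by linarith
  qed
  show ?thesis
    using *[of K L M] *[of M L K] assms
    by (auto simp: hausdorff_distance_le_iff hausdorff_distance_commute add.commute)
qed

lemma hausdorff_distance_eq_0_iff:
  fixes K L :: "'a::metric_space set"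
  assumes "K \<noteq> {}" "L \<noteq> {}" "compact K" "compact L"
  shows "hausdorff_distance K L = 0 \<longleftrightarrow> K = L"
proof -
  have "hausdorff_distance K L = 0 \<longleftrightarrow> hausdorff_distance K L \<le> 0"
    using hausdorff_distance_nonneg[of K L] by linarith
  also have "\<dots> \<longleftrightarrow> (\<forall>x\<in>K. infdist x L = 0) \<and> (\<forall>y\<in>L. infdist y K = 0)"
    using assms by (auto simp: hausdorff_distance_le_iff compact_imp_bounded order_antisym infdist_nonneg)
  also have "\<dots> \<longleftrightarrow> K = L"
    using assms by (auto simp: compact_imp_closed simp flip: in_closed_iff_infdist_zero)
  finally show ?thesis .
qed

interpretation hausdorff: Metric_space "convex_bodies :: 'a::real_normed_vector set set" hausdorff_distance
proof
  show "hausdorff_distance K L = 0 \<longleftrightarrow> K = L"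
    if "K \<in> convex_bodies" "L \<in> convex_bodies" for K L :: "'a set"
    using that by (auto simp: convex_bodies_def hausdorff_distance_eq_0_iff)
  show "hausdorff_distance K M \<le> hausdorff_distance K L + hausdorff_distance L M"
    if "K \<in> convex_bodies" "L \<in> convex_bodies" "M \<in> convex_bodies" for K L M :: "'a set"
    using that by (auto simp: convex_bodies_def compact_imp_bounded intro!: hausdorff_distance_triangle)
qed (simp_all add: hausdorff_distance_nonneg hausdorff_distance_commute)


section \<open>The rotation-invariant probability measure on the unit sphere\<close>

text \<open>Rotations are all orthogonal transformations, so that the measure is unique in dimension
  one as well; in higher dimension the proper rotations determine the same measure.\<close>

definition rotation_invariant_prob :: "'a::euclidean_space measure \<Rightarrow> bool" where
  "rotation_invariant_prob M \<longleftrightarrow>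
     prob_space M \<and> sets M = sets (restrict_space borel (sphere 0 1)) \<and>
     (\<forall>T. orthogonal_transformation T \<longrightarrow> distr M M T = M)"

definition sphere_measure :: "'a::euclidean_space measure" where
  "sphere_measure = (THE M. rotation_invariant_prob M)"

lemma borel_measurable_orthogonal_transformation:
  fixes T :: "'a::euclidean_space \<Rightarrow> 'a"
  assumes "orthogonal_transformation T"
  shows "T \<in> borel_measurable borel"
  using assms
  by (intro borel_measurable_continuous_onI linear_continuous_on)
     (simp add: orthogonal_transformation_linear flip: linear_conv_bounded_linear)

lemma nn_integral_lborel_translate:
  fixes f :: "'a::euclidean_space \<Rightarrow> ennreal"
  assumes [measurable]: "f \<in> borel_measurable borel"
  shows "(\<integral>\<^sup>+x. f (a + x) \<partial>lborel) = (\<integral>\<^sup>+x. f x \<partial>lborel)"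
proof -
  have "(\<integral>\<^sup>+x. f x \<partial>lborel) = (\<integral>\<^sup>+x. f x \<partial>distr lborel borel ((+) a))"
    by (simp add: lborel_distr_plus)
  also have "\<dots> = (\<integral>\<^sup>+x. f (a + x) \<partial>lborel)"
    by (subst nn_integral_distr) auto
  finally show ?thesis ..
qed

lemma nn_integral_lborel_reflect:
  fixes f :: "'a::euclidean_space \<Rightarrow> ennreal"
  assumes [measurable]: "f \<in> borel_measurable borel"
  shows "(\<integral>\<^sup>+x. f (a - x) \<partial>lborel) = (\<integral>\<^sup>+x. f x \<partial>lborel)"
proof -
  have "lborel = density (distr lborel borel (\<lambda>x::'a. a + (-1) *\<^sub>R x)) (\<lambda>_. 1)"
    using lborel_affine[of "-1" a] by simp
  then have "lborel = distr lborel borel (\<lambda>x::'a. a - x)"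
    by (simp add: density_1)
  then have "(\<integral>\<^sup>+x. f x \<partial>lborel) = (\<integral>\<^sup>+x. f x \<partial>distr lborel borel (\<lambda>x. a - x))"
    by simp
  also have "\<dots> = (\<integral>\<^sup>+x. f (a - x) \<partial>lborel)"
    by (subst nn_integral_distr) auto
  finally show ?thesis ..
qed

lemma emeasure_lborel_orthogonal_vimage:
  fixes T :: "'a::euclidean_space \<Rightarrow> 'a"
  assumes T: "orthogonal_transformation T" and A[measurable]: "A \<in> sets borel"
  shows "emeasure lborel (T -` A) = emeasure lborel A"
proof -
  note [measurable] = borel_measurable_orthogonal_transformation[OF T]
  define B :: "'a set" where "B = ball 0 1"
  have [measurable]: "B \<in> sets borel" by (simp add: B_def)
  have TB: "T x \<in> B \<longleftrightarrow> x \<in> B" for x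
    using T by (simp add: B_def orthogonal_transformation_norm)
  have vim: "T -` C \<in> sets lborel" if "C \<in> sets borel" for C
    using measurable_sets[OF borel_measurable_orthogonal_transformation[OF T] that] by simp
  have ind: "(\<integral>\<^sup>+x. indicator C (T x) \<partial>lborel) = emeasure lborel (T -` C)"
    if "C \<in> sets borel" for C
    using vim[OF that] by (simp add: indicator_def flip: nn_integral_indicator)
  have "emeasure lborel (T -` A) * emeasure lborel B
      = (\<integral>\<^sup>+x. indicator A (T x) * (\<integral>\<^sup>+y. indicator B (T x + y) \<partial>lborel) \<partial>lborel)"
    by (simp add: nn_integral_lborel_translate[of "indicator B"] nn_integral_multc ind)
  also have "\<dots> = (\<integral>\<^sup>+x. (\<integral>\<^sup>+y. indicator A (T x) * indicator B (T x + y) \<partial>lborel) \<partial>lborel)"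
    by (simp add: nn_integral_cmult)
  also have "\<dots> = (\<integral>\<^sup>+y. (\<integral>\<^sup>+x. indicator A (T x) * indicator B (T x + y) \<partial>lborel) \<partial>lborel)"
    by (rule lborel_pair.Fubini'[symmetric]) (measurable)
  also have "\<dots> = (\<integral>\<^sup>+y. (\<integral>\<^sup>+x. indicator A (T x - y) * indicator B (T x) \<partial>lborel) \<partial>lborel)"
  proof (rule nn_integral_cong)
    fix y :: 'a
    obtain z where z: "T z = y"
      using orthogonal_transformation_surj[OF T] by (metis surjD)
    have "T (- z + x) = T x - y" for x
      using T z linear_add[of T "-z" x] linear_neg[of T z]
      by (simp add: orthogonal_transformation_linear)
    then show "(\<integral>\<^sup>+x. indicator A (T x) * indicator B (T x + y) \<partial>lborel)
        = (\<integral>\<^sup>+x. indicator A (T x - y) * indicator B (T x) \<partial>(lborel :: 'a measure))"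
      by (subst nn_integral_lborel_translate[where a = "- z", symmetric]) simp_all
  qed
  also have "\<dots> = (\<integral>\<^sup>+x. (\<integral>\<^sup>+y. indicator A (T x - y) * indicator B (T x) \<partial>lborel) \<partial>lborel)"
    by (rule lborel_pair.Fubini') (measurable)
  also have "\<dots> = (\<integral>\<^sup>+x. emeasure lborel A * indicator B (T x) \<partial>lborel)"
    by (simp add: nn_integral_multc nn_integral_lborel_reflect[of "indicator A"])
  also have "\<dots> = emeasure lborel A * emeasure lborel B"
    by (simp add: nn_integral_cmult TB indicator_def flip: nn_integral_indicator)
  finally have "emeasure lborel (T -` A) * emeasure lborel B = emeasure lborel A * emeasure lborel B" .
  moreover have "emeasure lborel B \<noteq> 0" "emeasure lborel B \<noteq> \<infinity>"
    using unit_ball_vol_pos[of "real DIM('a)"]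
    by (simp_all add: B_def emeasure_ball less_imp_neq[symmetric])
  moreover from this have "emeasure lborel A' = emeasure lborel A' * emeasure lborel B / emeasure lborel B"
    for A' :: "'a set"
    by (simp add: ennreal_divide_self less_top zero_less_iff_neq_zero flip: ennreal_times_divide)
  ultimately show ?thesis by metis
qed

lemma rotation_invariant_prob_exists: "\<exists>M :: 'a::euclidean_space measure. rotation_invariant_prob M"
proof -
  define B :: "'a set" where "B = ball 0 1 - {0}"
  define S :: "'a measure" where "S = restrict_space borel (sphere 0 1)"
  define p :: "'a \<Rightarrow> 'a" where "p = (\<lambda>x. if x = 0 then SOME b. b \<in> Basis else sgn x)"
  define M0 where "M0 = uniform_measure lborel B"
  define M where "M = distr M0 S p"
  have [measurable]: "B \<in> sets borel" by (simp add: B_def)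
  have "emeasure lborel B = emeasure lborel (ball (0::'a) 1)"
    unfolding B_def by (subst emeasure_Diff) auto
  then have B: "emeasure lborel B \<noteq> 0" "emeasure lborel B \<noteq> \<infinity>"
    using unit_ball_vol_pos[of "real DIM('a)"] by (simp_all add: emeasure_ball less_imp_neq[symmetric])
  have pS: "p x \<in> sphere 0 1" for x
    by (auto simp: p_def norm_sgn some_in_eq)
  have "p \<in> borel_measurable borel"
    unfolding p_def sgn_div_norm by measurable
  then have pm: "p \<in> measurable M0 S"
    unfolding S_def by (intro measurable_restrict_space2) (use pS in \<open>auto simp: M0_def\<close>)
  have M0: "prob_space M0"
    unfolding M0_def using B by (intro prob_space_uniform_measure) auto
  have inv: "distr M M T = M" if T: "orthogonal_transformation T" for T
  proof (rule measure_eqI)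
    fix A assume "A \<in> sets (distr M M T)"
    then have A: "A \<in> sets S" by (simp add: M_def)
    have Tm: "T \<in> measurable S S"
      using borel_measurable_orthogonal_transformation[OF T] T
      unfolding S_def by (intro measurable_restrict_space3) (auto simp: orthogonal_transformation_norm)
    then have Tm': "T \<in> measurable M M" by (simp add: M_def)
    have sp: "space S = sphere 0 1" by (simp add: S_def space_restrict_space)
    have sets: "p -` A' \<in> sets borel" if "A' \<in> sets S" for A'
      using measurable_sets[OF pm that] by (simp add: M0_def)
    have M_eq: "emeasure M A' = emeasure lborel (B \<inter> p -` A') / emeasure lborel B"
      if "A' \<in> sets S" for A'
    proof -
      have "emeasure M A' = emeasure M0 (p -` A')"
        unfolding M_def by (subst emeasure_distr[OF pm that]) (simp add: M0_def)
      then show ?thesis using sets[OF that] by (simp add: M0_def)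
    qed
    have TA: "T -` A \<inter> sphere 0 1 \<in> sets S"
      using measurable_sets[OF Tm A] by (simp add: sp)
    have Tx0: "T x = 0 \<longleftrightarrow> x = 0" for x
      using T by (metis norm_eq_zero orthogonal_transformation_norm)
    have pT: "p (T x) = T (p x)" if "x \<in> B" for x
      using that T
      by (simp add: B_def p_def Tx0 sgn_div_norm orthogonal_transformation_norm
          orthogonal_transformation_linear linear_scale)
    have "B \<inter> p -` (T -` A \<inter> sphere 0 1) = T -` (B \<inter> p -` A)"
      using pT pS T by (auto simp: B_def Tx0 orthogonal_transformation_norm)
    moreover have "B \<inter> p -` A \<in> sets borel" using sets[OF A] by simp
    ultimately have "emeasure M (T -` A \<inter> sphere 0 1) = emeasure M A"
      using emeasure_lborel_orthogonal_vimage[OF T] unfolding M_eq[OF TA] M_eq[OF A] by metis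
    moreover have "A \<in> sets M" "space M = sphere 0 1"
      using A by (simp_all add: M_def sp)
    ultimately show "emeasure (distr M M T) A = emeasure M A"
      by (simp add: emeasure_distr[OF Tm'])
  qed simp
  have "rotation_invariant_prob M"
    unfolding rotation_invariant_prob_def
    using inv prob_space.prob_space_distr[OF M0 pm] by (auto simp: M_def S_def)
  then show ?thesis ..
qed

lemma orthogonal_transformation_transitive:
  fixes x y :: "'a::euclidean_space"
  assumes "norm x = norm y"
  shows "\<exists>T. orthogonal_transformation T \<and> T x = y"
proof (cases "x = y")
  case True
  then show ?thesis by (intro exI[of _ "\<lambda>z. z"]) (simp add: orthogonal_transformation_def linear_id[unfolded id_def])
next
  case False
  define w where "w = x - y"
  define T where "T = (\<lambda>z. z - ((z \<bullet> w) * (2 / (w \<bullet> w))) *\<^sub>R w)"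
  have w: "w \<bullet> w \<noteq> 0" using False by (simp add: w_def)
  have "linear T"
  proof (rule linearI)
    show "T (x + y) = T x + T y" for x y
      unfolding T_def inner_add_left distrib_right scaleR_add_left by (rule add_diff_add)
    show "T (r *\<^sub>R x) = r *\<^sub>R T x" for r x
      unfolding T_def inner_scaleR_left scaleR_diff_right scaleR_scaleR mult.assoc by (rule refl)
  qed
  moreover have "T u \<bullet> T v = u \<bullet> v" for u v
  proof -
    define a b where "a = (u \<bullet> w) * (2 / (w \<bullet> w))" and "b = (v \<bullet> w) * (2 / (w \<bullet> w))"
    have ab: "a * (w \<bullet> w) = 2 * (u \<bullet> w)" "b * (w \<bullet> w) = 2 * (v \<bullet> w)"
      using w by (simp_all add: a_def b_def)
    have "T u \<bullet> T v = u \<bullet> v - b * (u \<bullet> w) - a * (v \<bullet> w) + a * (b * (w \<bullet> w))"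
      unfolding T_def a_def[symmetric] b_def[symmetric]
      by (simp add: inner_diff_left inner_diff_right inner_commute[of w u] inner_commute[of w v]
          right_diff_distrib)
    also have "\<dots> = u \<bullet> v + (a * (v \<bullet> w) - b * (u \<bullet> w))"
      unfolding ab by simp
    also have "a * (v \<bullet> w) = b * (u \<bullet> w)"
      by (simp add: a_def b_def)
    finally show ?thesis by simp
  qed
  ultimately have "orthogonal_transformation T"
    by (simp add: orthogonal_transformation_def)
  moreover have "2 * (x \<bullet> w) = w \<bullet> w"
    using assms by (simp add: w_def inner_diff_left inner_diff_right inner_commute[of y x] norm_eq)
  then have "(2 * (x \<bullet> w)) / (w \<bullet> w) = 1"
    using w by (metis divide_self)
  then have "(x \<bullet> w) * (2 / (w \<bullet> w)) = 1"
    by (simp only: times_divide_eq_right mult.commute)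
  then have "T x = y"
    unfolding T_def by (simp only: scaleR_one) (simp add: w_def)
  ultimately show ?thesis by blast
qed

lemma rotation_invariant_prob_cap:
  fixes M :: "'a::euclidean_space measure"
  assumes M: "rotation_invariant_prob M" and x: "norm x = 1" and y: "norm y = 1"
  shows "emeasure M (sphere 0 1 \<inter> ball x r) = emeasure M (sphere 0 1 \<inter> ball y r)"
proof -
  obtain T where T: "orthogonal_transformation T" and Tx: "T x = y"
    using orthogonal_transformation_transitive[of x y] x y by auto
  have sM: "sets M = sets (restrict_space borel (sphere 0 1))" and inv: "distr M M T = M"
    using M T by (auto simp: rotation_invariant_prob_def)
  have sp: "space M = sphere 0 1"
    using sets_eq_imp_space_eq[OF sM] by (simp add: space_restrict_space)
  have "T \<in> measurable (restrict_space borel (sphere 0 1)) (restrict_space borel (sphere 0 1))"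
    using borel_measurable_orthogonal_transformation[OF T] T
    by (intro measurable_restrict_space3) (auto simp: orthogonal_transformation_norm)
  then have Tm: "T \<in> measurable M M"
    using measurable_cong_sets[OF sM sM] by auto
  have dT: "dist (T u) (T v) = dist u v" for u v
    using orthogonal_transformation_norm[OF T, of "u - v"] linear_diff[of T u v]
    by (simp add: dist_norm orthogonal_transformation_linear[OF T])
  have "sphere 0 1 \<inter> ball y r \<in> sets M"
    by (auto simp: sM sets_restrict_space)
  then have "emeasure M (sphere 0 1 \<inter> ball y r)
      = emeasure M (T -` (sphere 0 1 \<inter> ball y r) \<inter> sphere 0 1)"
    using emeasure_distr[OF Tm] inv sp by simp
  also have "T -` (sphere 0 1 \<inter> ball y r) \<inter> sphere 0 1 = sphere 0 1 \<inter> ball x r"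
    using T dT[of x] unfolding Tx by (auto simp: orthogonal_transformation_norm)
  finally show ?thesis ..
qed

text \<open>Uniqueness: spherical caps of equal radius have equal measure, so Fubini's theorem for the
  relation \<open>dist x y < r\<close> compares two invariant measures, first on caps and then on open sets.\<close>

lemma rotation_invariant_prob_unique:
  fixes M N :: "'a::euclidean_space measure"
  assumes M: "rotation_invariant_prob M" and N: "rotation_invariant_prob N"
  shows "M = N"
proof -
  define S :: "'a measure" where "S = restrict_space borel (sphere 0 1)"
  have spS: "space S = sphere 0 1" by (simp add: S_def space_restrict_space)
  have props: "prob_space P" "sets P = sets S" "space P = sphere 0 1"
    if "rotation_invariant_prob P" for P :: "'a measure"
  proof -
    show "prob_space P" "sets P = sets S"
      using that by (auto simp: rotation_invariant_prob_def S_def)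
    then show "space P = sphere 0 1" using sets_eq_imp_space_eq spS by metis
  qed
  obtain e :: 'a where e: "norm e = 1" using norm_Basis nonempty_Basis by blast
  define c where "c P r = emeasure P (sphere 0 1 \<inter> ball e r)" for P :: "'a measure" and r
  have setsI: "sphere 0 1 \<inter> A \<in> sets S" if "A \<in> sets borel" for A
    using that by (auto simp: S_def sets_restrict_space)
  have cap: "emeasure P (sphere 0 1 \<inter> ball x r) = c P r"
    if "rotation_invariant_prob P" "norm x = 1" for P :: "'a measure" and x r
    unfolding c_def using rotation_invariant_prob_cap[OF that e] .
  have id_meas: "(\<lambda>x. x) \<in> borel_measurable P" if "rotation_invariant_prob P" for P :: "'a measure"
  proof -
    have "(\<lambda>x. x) \<in> borel_measurable S"
      unfolding S_def by (rule measurable_restrict_space1) simp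
    then show ?thesis
      using measurable_cong_sets[OF props(2)[OF that] refl] by auto
  qed
  have fubini: "(\<integral>\<^sup>+x. indicator W x * c Q r \<partial>P)
      = (\<integral>\<^sup>+y. emeasure P (W \<inter> (sphere 0 1 \<inter> ball y r)) \<partial>Q)"
    if P: "rotation_invariant_prob P" and Q: "rotation_invariant_prob Q" and W: "W \<in> sets borel"
    for P Q :: "'a measure" and r W
  proof -
    interpret P: prob_space P by (rule props[OF P])
    interpret Q: prob_space Q by (rule props[OF Q])
    interpret PQ: pair_sigma_finite P Q ..
    note [measurable] = id_meas[OF P] id_meas[OF Q] W
    have "(\<integral>\<^sup>+x. indicator W x * c Q r \<partial>P)
        = (\<integral>\<^sup>+x. indicator W x * (\<integral>\<^sup>+y. indicator (sphere 0 1 \<inter> ball x r) y \<partial>Q) \<partial>P)"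
      by (rule nn_integral_cong)
         (simp add: props[OF P] props[OF Q] setsI cap[OF Q])
    also have "\<dots> = (\<integral>\<^sup>+x. indicator W x * (\<integral>\<^sup>+y. (if dist x y < r then 1 else 0) \<partial>Q) \<partial>P)"
      by (intro nn_integral_cong arg_cong2[where f = "(*)"] refl)
         (auto simp: props[OF Q] indicator_def)
    also have "\<dots> = (\<integral>\<^sup>+x. (\<integral>\<^sup>+y. indicator W x * (if dist x y < r then 1 else 0) \<partial>Q) \<partial>P)"
      by (intro nn_integral_cong nn_integral_cmult[symmetric]) measurable
    also have "\<dots> = (\<integral>\<^sup>+y. (\<integral>\<^sup>+x. indicator W x * (if dist x y < r then 1 else 0) \<partial>P) \<partial>Q)"
      by (rule PQ.Fubini'[symmetric]) measurable
    also have "\<dots> = (\<integral>\<^sup>+y. (\<integral>\<^sup>+x. indicator (W \<inter> (sphere 0 1 \<inter> ball y r)) x \<partial>P) \<partial>Q)"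
      by (intro nn_integral_cong)
         (auto simp: props[OF P] indicator_def dist_commute)
    also have "\<dots> = (\<integral>\<^sup>+y. emeasure P (W \<inter> (sphere 0 1 \<inter> ball y r)) \<partial>Q)"
    proof (rule nn_integral_cong)
      fix y
      have "W \<inter> (sphere 0 1 \<inter> ball y r) \<in> sets P"
        using setsI[of "W \<inter> ball y r"] W props(2)[OF P] by (simp add: Int_left_commute)
      then show "(\<integral>\<^sup>+x. indicator (W \<inter> (sphere 0 1 \<inter> ball y r)) x \<partial>P)
          = emeasure P (W \<inter> (sphere 0 1 \<inter> ball y r))" by simp
    qed
    finally show ?thesis .
  qed
  have c_eq: "c M r = c N r" for r
  proof -
    interpret M: prob_space M by (rule props[OF M])
    interpret N: prob_space N by (rule props[OF N])
    have "c N r = (\<integral>\<^sup>+x. indicator UNIV x * c N r \<partial>M)" by (simp add: M.emeasure_space_1)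
    also have "\<dots> = (\<integral>\<^sup>+y. emeasure M (UNIV \<inter> (sphere 0 1 \<inter> ball y r)) \<partial>N)"
      by (rule fubini[OF M N]) simp
    also have "\<dots> = (\<integral>\<^sup>+y. c M r \<partial>N)"
      by (rule nn_integral_cong) (simp add: props[OF N] cap[OF M])
    also have "\<dots> = c M r" by (simp add: N.emeasure_space_1)
    finally show ?thesis ..
  qed
  have c_pos: "c P r \<noteq> 0" if P: "rotation_invariant_prob P" and r: "0 < r" for P :: "'a measure" and r
  proof
    assume 0: "c P r = 0"
    interpret P: prob_space P by (rule props[OF P])
    have "compact (sphere (0::'a) 1)" by simp
    then obtain F :: "'a set" where F: "finite F" "F \<subseteq> sphere 0 1" "sphere 0 1 \<subseteq> (\<Union>x\<in>F. ball x r)"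
      using r by (elim compactE_image[where C = "sphere 0 1" and f = "\<lambda>x. ball x r"]) auto
    have sph: "sphere 0 1 = (\<Union>x\<in>F. sphere 0 1 \<inter> ball x r)" using F by auto
    have "emeasure P (\<Union>x\<in>F. sphere 0 1 \<inter> ball x r) \<le> (\<Sum>x\<in>F. emeasure P (sphere 0 1 \<inter> ball x r))"
      using F(1) by (intro emeasure_subadditive_finite) (auto simp: props(2)[OF P] setsI)
    also have "\<dots> = 0" using F(2) 0 by (auto intro!: sum.neutral simp: cap[OF P] subset_iff)
    finally have "emeasure P (space P) = 0" using sph props(3)[OF P] by simp
    then show False using P.emeasure_space_1 by simp
  qed
  have open_le: "emeasure P (sphere 0 1 \<inter> U) \<le> emeasure Q (sphere 0 1 \<inter> U)"
    if P: "rotation_invariant_prob P" and Q: "rotation_invariant_prob Q" and U: "open U"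
      and c: "\<And>r. c P r = c Q r" for P Q :: "'a measure" and U
  proof (cases "U = UNIV")
    case True
    then show ?thesis
      using prob_space.emeasure_space_1[OF props(1)[OF P]] prob_space.emeasure_space_1[OF props(1)[OF Q]]
      by (simp add: props(3)[OF P] props(3)[OF Q])
  next
    case False
    then have neU: "- U \<noteq> {}" by auto
    interpret P: prob_space P by (rule props[OF P])
    interpret Q: prob_space Q by (rule props[OF Q])
    define V where "V k = {x. inverse (of_nat (Suc k)) \<le> infdist x (- U)}" for k :: nat
    have "closed (V k)" for k
      unfolding V_def by (intro closed_Collect_le continuous_intros)
    then have V[measurable]: "V k \<in> sets borel" for k by (rule borel_closed)
    have V_sets: "sphere 0 1 \<inter> V k \<in> sets P" for k by (simp add: props(2)[OF P] setsI)
    have VU: "y \<in> U" if "x \<in> V k" "dist x y < inverse (of_nat (Suc k))" for x y k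
      using that infdist_le[of y "- U" x] by (fastforce simp: V_def)
    have Vle: "emeasure P (sphere 0 1 \<inter> V k) \<le> emeasure Q (sphere 0 1 \<inter> U)" for k
    proof -
      define r :: real where "r = inverse (of_nat (Suc k))"
      have r: "r > 0" by (simp add: r_def)
      have "emeasure P (sphere 0 1 \<inter> V k) * c Q r = (\<integral>\<^sup>+x. indicator (V k) x * c Q r \<partial>P)"
      proof -
        have "(\<integral>\<^sup>+x. indicator (V k) x * c Q r \<partial>P)
            = (\<integral>\<^sup>+x. c Q r * indicator (sphere 0 1 \<inter> V k) x \<partial>P)"
          by (rule nn_integral_cong) (auto simp: props[OF P] indicator_def)
        then show ?thesis using V_sets by (simp add: nn_integral_cmult_indicator mult.commute)
      qed
      also have "\<dots> = (\<integral>\<^sup>+y. emeasure P (V k \<inter> (sphere 0 1 \<inter> ball y r)) \<partial>Q)"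
        by (rule fubini[OF P Q V])
      also have "\<dots> \<le> (\<integral>\<^sup>+y. c P r * indicator (sphere 0 1 \<inter> U) y \<partial>Q)"
      proof (rule nn_integral_mono)
        fix y assume "y \<in> space Q"
        then have y: "norm y = 1" by (simp add: props[OF Q])
        show "emeasure P (V k \<inter> (sphere 0 1 \<inter> ball y r)) \<le> c P r * indicator (sphere 0 1 \<inter> U) y"
        proof (cases "y \<in> U")
          case True
          have "emeasure P (V k \<inter> (sphere 0 1 \<inter> ball y r)) \<le> emeasure P (sphere 0 1 \<inter> ball y r)"
            by (rule emeasure_mono) (auto simp: props(2)[OF P] setsI)
          then show ?thesis using True y by (simp add: cap[OF P])
        next
          case False
          then have "V k \<inter> (sphere 0 1 \<inter> ball y r) = {}"
            using VU by (auto simp: r_def dist_commute)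
          then show ?thesis by simp
        qed
      qed
      also have "\<dots> = emeasure Q (sphere 0 1 \<inter> U) * c Q r"
        using U by (simp add: nn_integral_cmult_indicator props(2)[OF Q] setsI c mult.commute)
      finally have le: "emeasure P (sphere 0 1 \<inter> V k) * c Q r \<le> emeasure Q (sphere 0 1 \<inter> U) * c Q r" .
      have "c Q r \<noteq> \<top>" by (simp add: c_def)
      then have "0 < c Q r" "c Q r < \<top>" using c_pos[OF Q r] by (auto simp: less_top zero_less_iff_neq_zero)
      with le show ?thesis
        by (meson ennreal_mult_strict_right_mono leD leI)
    qed
    have UV: "sphere 0 1 \<inter> U = (\<Union>k. sphere 0 1 \<inter> V k)"
    proof -
      have "\<exists>k. x \<in> V k" if "x \<in> U" for x
      proof -
        have "infdist x (- U) > 0"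
          using that U neU by (metis Compl_iff closed_Compl in_closed_iff_infdist_zero
              infdist_nonneg less_eq_real_def)
        then obtain k where "inverse (of_nat (Suc k)) < infdist x (- U)"
          using reals_Archimedean by blast
        then show ?thesis by (auto simp: V_def intro!: exI[of _ k])
      qed
      moreover have "x \<in> U" if "x \<in> V k" for x k using VU[OF that, of x] by simp
      ultimately show ?thesis by blast
    qed
    have "incseq (\<lambda>k. sphere 0 1 \<inter> V k)"
    proof (rule incseq_SucI)
      fix k
      have le: "inverse (real (Suc (Suc k))) \<le> inverse (real (Suc k))" by (simp add: field_simps)
      then show "sphere 0 1 \<inter> V k \<subseteq> sphere 0 1 \<inter> V (Suc k)"
        unfolding V_def by (blast intro: order_trans[OF le])
    qed
    then have "emeasure P (\<Union>k. sphere 0 1 \<inter> V k) = (SUP k. emeasure P (sphere 0 1 \<inter> V k))"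
      using V_sets by (intro SUP_emeasure_incseq[symmetric]) auto
    also have "\<dots> \<le> emeasure Q (sphere 0 1 \<inter> U)"
      by (rule SUP_least) (rule Vle)
    finally show ?thesis by (simp add: UV)
  qed
  have open_eq: "emeasure M (sphere 0 1 \<inter> U) = emeasure N (sphere 0 1 \<inter> U)" if "open U" for U
    using open_le[OF M N that] open_le[OF N M that] c_eq by (simp add: order_antisym)
  have em: "emeasure (distr P borel (\<lambda>x. x)) A = emeasure P (sphere 0 1 \<inter> A)"
    if "rotation_invariant_prob P" "A \<in> sets borel" for P :: "'a measure" and A
    using that by (subst emeasure_distr[OF id_meas]) (auto simp: props Int_commute)
  have "distr M borel (\<lambda>x. x) = distr N borel (\<lambda>x. x)"
  proof (rule measure_eqI_generator_eq[where E = "Collect open" and \<Omega> = UNIV and A = "\<lambda>_. UNIV"])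
    show "Int_stable (Collect open :: 'a set set)" by (auto simp: Int_stable_def)
    show "emeasure (distr M borel (\<lambda>x. x)) U = emeasure (distr N borel (\<lambda>x. x)) U"
      if "U \<in> Collect open" for U
      using that by (simp add: em[OF M] em[OF N] open_eq)
    show "emeasure (distr M borel (\<lambda>x. x)) UNIV \<noteq> \<infinity>"
      using prob_space.emeasure_space_1[OF props(1)[OF M]] by (simp add: em[OF M] props(3)[OF M])
  qed (auto simp: sets_borel)
  then have *: "emeasure M (sphere 0 1 \<inter> A) = emeasure N (sphere 0 1 \<inter> A)" if "A \<in> sets borel" for A
    using em[OF M that] em[OF N that] by simp
  show ?thesis
  proof (rule measure_eqI)
    show "sets M = sets N" by (simp add: props(2)[OF M] props(2)[OF N])
    show "emeasure M A = emeasure N A" if "A \<in> sets M" for A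
      using that * by (auto simp: props(2)[OF M] S_def sets_restrict_space)
  qed
qed

lemma rotation_invariant_prob_sphere_measure:
  "rotation_invariant_prob (sphere_measure :: 'a::euclidean_space measure)"
  unfolding sphere_measure_def
  by (rule theI') (metis rotation_invariant_prob_exists rotation_invariant_prob_unique)


section \<open>The Steiner point\<close>

definition support_function :: "'a::euclidean_space set \<Rightarrow> 'a \<Rightarrow> real" where
  "support_function K u = (SUP x\<in>K. u \<bullet> x)"

text \<open>On \<^typ>\<open>complex ^ 'n\<close> the class operation \<open>\<bullet>\<close> is the real inner product and \<open>DIM\<close> is
  the real dimension, twice the cardinality of \<open>'n\<close>.\<close>

definition steiner_point :: "'a::euclidean_space set \<Rightarrow> 'a" where
  "steiner_point K = DIM('a) *\<^sub>R (LINT u|sphere_measure. support_function K u *\<^sub>R u)"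


section \<open>Unitary affine transformations\<close>

definition adjoint_matrix :: "complex^'n^'m \<Rightarrow> complex^'m^'n" where
  "adjoint_matrix A = (\<chi> i j. cnj (A $ j $ i))"

definition unitary_group :: "(complex^'n^'n) set" where
  "unitary_group = {A. adjoint_matrix A ** A = mat 1 \<and> A ** adjoint_matrix A = mat 1}"

definition unitary_affine_group :: "(complex^'n \<Rightarrow> complex^'n) set" where
  "unitary_affine_group = {(\<lambda>x. A *v x + b) | A b. A \<in> unitary_group}"

end

theory Submission
  imports Defs
begin

text \<open>
  A Minkowski additive and continuous map \<open>f\<close> is linear for nonnegative combinations of bodies,
  and by continuity it commutes with integrals of bodies: if
  \<open>h\<^sub>L(u) = \<integral> h\<^bsub>B w\<^esub>(u) d\<mu>(w)\<close> for all unit vectors \<open>u\<close>, then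
  \<open>f(L) = \<integral> f(B w) d\<mu>(w)\<close> (lemma \<open>map_integral\<close>).  The idea is to write a body \<open>K\<close>, up to a
  small error and up to adding a ball, as such an integral over bodies \<open>B w\<close> that are as symmetric
  about the line through \<open>w\<close> as possible.  On these the unitary group determines \<open>f\<close>.

  For \<open>0 < \<epsilon> < 1\<close> let \<open>\<psi>\<close> be a multiple of \<open>z \<mapsto> max 0 (\<epsilon>\<^sup>2 - |z|\<^sup>2)\<close> with integral one.  The
  smoothed body \<open>T\<^sub>\<epsilon> K\<close> has the support function
  \<open>u \<mapsto> \<integral> h\<^sub>K(u + |u| z) \<psi>(z) dz\<close>, which is sublinear because \<open>\<psi>\<close> is even
  (\<open>sublinear_smoothing\<close>), and \<open>T\<^sub>\<epsilon> K\<close> tends to \<open>K\<close>.  For a unit vector \<open>u\<close> the integral becomes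
  \<open>\<integral> h\<^sub>K(w) \<psi>(w - u) dw\<close> after a translation, and
  \<open>\<epsilon>\<^sup>2 - |w - u|\<^sup>2 = 2 w\<bullet>u - (1 + |w|\<^sup>2 - \<epsilon>\<^sup>2)\<close> shows that \<open>u \<mapsto> \<psi>(w - u)\<close> is, up to an additive
  and a multiplicative constant, the support function of the convex hull of the point \<open>2 w\<close> and a
  ball, a cap body.  Hence, when \<open>0 \<in> K\<close> so that the weight \<open>h\<^sub>K\<close> is nonnegative, \<open>T\<^sub>\<epsilon> K\<close> plus
  some ball is the integral of the cap bodies with weight \<open>h\<^sub>K\<close> (\<open>map_smoothed_body\<close>).

  Unitary equivariance enters twice.  Since \<open>-1\<close> is unitary, \<open>f\<close> vanishes on centred balls.  The
  complex reflections that fix \<open>w\<close> fix the cap body of \<open>w\<close>, so its image under \<open>f\<close> is a complex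
  multiple of \<open>w\<close>; as the unitary group is transitive on spheres, the factor depends on \<open>|w|\<close>
  alone (\<open>map_cap_body\<close>).  Therefore \<open>f(T\<^sub>\<epsilon> K)\<close> is the integral of a radial complex function
  times \<open>h\<^sub>K(v) v\<close>, where \<open>v\<close> is the direction of \<open>w\<close>, and integration in polar coordinates
  (\<open>integral_radial\<close>) gives \<open>f(T\<^sub>\<epsilon> K) = C\<^sub>\<epsilon> I(K)\<close> with \<open>I(K) = \<integral> h\<^sub>K(v) v dv\<close> over the unit
  sphere and a complex number \<open>C\<^sub>\<epsilon>\<close> that does not depend on \<open>K\<close>.

  Now let \<open>\<epsilon>\<close> tend to zero.  Both \<open>f\<close> and the Steiner point map send the unit ball with centre \<open>x\<close>
  to \<open>x\<close>, so \<open>C\<^sub>\<epsilon>\<close> converges to the real dimension, and \<open>f(K)\<close> is the Steiner point for all \<open>K\<close>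
  that contain the origin.  Adding a large centred ball to \<open>K\<close> changes neither side, which removes
  that condition.
\<close>

section \<open>Support functions\<close>

lemma convex_bodies_iff: "K \<in> convex_bodies \<longleftrightarrow> K \<noteq> {} \<and> compact K \<and> convex K"
  by (simp add: convex_bodies_def)

lemma inner_le_support_function:
  fixes K :: "'a::euclidean_space set"
  assumes "K \<in> convex_bodies" "x \<in> K"
  shows "u \<bullet> x \<le> support_function K u"
proof -
  have "compact ((\<lambda>x. u \<bullet> x) ` K)"
    using assms by (intro compact_continuous_image continuous_intros) (simp add: convex_bodies_iff)
  then have "bdd_above ((\<lambda>x. u \<bullet> x) ` K)"
    by (simp add: bounded_imp_bdd_above compact_imp_bounded)
  then show ?thesis
    unfolding support_function_def using assms(2) by (rule cSUP_upper2) simp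
qed

lemma support_function_eqI:
  fixes K :: "'a::euclidean_space set"
  assumes "K \<in> convex_bodies" "x \<in> K" "u \<bullet> x = s" "\<And>y. y \<in> K \<Longrightarrow> u \<bullet> y \<le> s"
  shows "support_function K u = s"
proof (rule order_antisym)
  show "support_function K u \<le> s"
    unfolding support_function_def using assms by (intro cSUP_least) auto
  show "s \<le> support_function K u"
    using inner_le_support_function[OF assms(1,2), of u] assms(3) by simp
qed

lemma support_function_attained:
  fixes K :: "'a::euclidean_space set"
  assumes "K \<in> convex_bodies"
  obtains x where "x \<in> K" "support_function K u = u \<bullet> x"
proof -
  have "\<exists>x\<in>K. \<forall>y\<in>K. u \<bullet> y \<le> u \<bullet> x"
    using assms by (intro continuous_attains_sup continuous_intros) (auto simp: convex_bodies_iff)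
  then obtain x where "x \<in> K" "\<And>y. y \<in> K \<Longrightarrow> u \<bullet> y \<le> u \<bullet> x" by blast
  with support_function_eqI[OF assms this(1) refl] that show thesis by blast
qed

lemma convex_bodies_plus:
  fixes K L :: "'a::euclidean_space set"
  assumes "K \<in> convex_bodies" "L \<in> convex_bodies"
  shows "K + L \<in> convex_bodies"
proof -
  have "K + L = {x + y | x y. x \<in> K \<and> y \<in> L}"
    by (auto simp: set_plus_def)
  then show ?thesis
    using assms compact_sums[of K L] convex_set_plus[of K L] by (auto simp: convex_bodies_iff)
qed

lemma support_function_plus:
  fixes K L :: "'a::euclidean_space set"
  assumes K: "K \<in> convex_bodies" and L: "L \<in> convex_bodies"
  shows "support_function (K + L) u = support_function K u + support_function L u"
proof -
  obtain x where "x \<in> K" "support_function K u = u \<bullet> x"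
    by (rule support_function_attained[OF K])
  moreover obtain y where "y \<in> L" "support_function L u = u \<bullet> y"
    by (rule support_function_attained[OF L])
  ultimately show ?thesis
    using inner_le_support_function[OF K, of _ u] inner_le_support_function[OF L, of _ u]
    by (intro support_function_eqI[OF convex_bodies_plus[OF K L], of "x + y"])
       (fastforce simp: inner_add_right elim!: set_plus_elim intro!: add_mono)+
qed

lemma convex_bodies_scaleR:
  fixes K :: "'a::euclidean_space set"
  assumes "K \<in> convex_bodies"
  shows "(*\<^sub>R) t ` K \<in> convex_bodies"
  using assms by (auto simp: convex_bodies_iff compact_scaling convex_scaling)

lemma support_function_scaleR:
  fixes K :: "'a::euclidean_space set"
  assumes K: "K \<in> convex_bodies" and t: "0 \<le> t"
  shows "support_function ((*\<^sub>R) t ` K) u = t * support_function K u"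
proof -
  obtain x where "x \<in> K" "support_function K u = u \<bullet> x"
    by (rule support_function_attained[OF K])
  then show ?thesis
    using t
    by (intro support_function_eqI[OF convex_bodies_scaleR[OF K], of "t *\<^sub>R x"])
       (use inner_le_support_function[OF K, of _ u] in \<open>auto intro!: mult_left_mono\<close>)
qed

lemma convex_bodies_singleton [simp]: "{x} \<in> convex_bodies"
  by (simp add: convex_bodies_iff)

lemma support_function_singleton [simp]: "support_function {x} u = u \<bullet> x"
  by (simp add: support_function_def)

lemma convex_bodies_cball [simp]:
  fixes x :: "'a::euclidean_space"
  shows "0 \<le> r \<Longrightarrow> cball x r \<in> convex_bodies"
  by (auto simp: convex_bodies_iff)

lemma support_function_cball:
  fixes u :: "'a::euclidean_space"
  assumes "0 \<le> r"
  shows "support_function (cball 0 r) u = r * norm u"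
proof (rule support_function_eqI)
  show "r *\<^sub>R sgn u \<in> cball 0 r"
    using assms by (simp add: norm_sgn)
  show "u \<bullet> r *\<^sub>R sgn u = r * norm u"
    by (cases "u = 0") (simp_all add: sgn_div_norm dot_square_norm power2_eq_square)
  show "u \<bullet> y \<le> r * norm u" if "y \<in> cball 0 r" for y
    using that norm_cauchy_schwarz[of u y] mult_left_mono[of "norm y" r "norm u"]
    by (simp add: mult.commute)
qed (use assms in simp)

section \<open>Sublinear functions as support functions\<close>

definition sublinear :: "('a::real_vector \<Rightarrow> real) \<Rightarrow> bool" where
  "sublinear H \<longleftrightarrow>
     (\<forall>u v. H (u + v) \<le> H u + H v) \<and> (\<forall>t u. 0 \<le> t \<longrightarrow> H (t *\<^sub>R u) = t * H u)"

lemma sublinear_support_function: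
  fixes K :: "'a::euclidean_space set"
  assumes K: "K \<in> convex_bodies"
  shows "sublinear (support_function K)"
  unfolding sublinear_def
proof (intro conjI allI impI)
  fix u v
  obtain x where "x \<in> K" "support_function K (u + v) = (u + v) \<bullet> x"
    by (rule support_function_attained[OF K])
  then show "support_function K (u + v) \<le> support_function K u + support_function K v"
    using inner_le_support_function[OF K, of x] by (simp add: inner_add_left add_mono)
next
  fix t u assume t: "0 \<le> (t::real)"
  obtain x where "x \<in> K" "support_function K u = u \<bullet> x"
    by (rule support_function_attained[OF K])
  then show "support_function K (t *\<^sub>R u) = t * support_function K u"
    using t
    by (intro support_function_eqI[OF K]) (use inner_le_support_function[OF K, of _ u] in \<open>auto intro!: mult_left_mono\<close>)
qed

lemma sublinear_diff_le:
  assumes "sublinear H"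
  shows "H u - H v \<le> H (u - v)"
proof -
  have "H ((u - v) + v) \<le> H (u - v) + H v"
    using assms unfolding sublinear_def by blast
  then show ?thesis by simp
qed

lemma sublinear_bound:
  fixes H :: "'a::euclidean_space \<Rightarrow> real"
  assumes "sublinear H"
  obtains C where "0 \<le> C" "\<And>u. H u \<le> C * norm u"
proof -
  have hom: "\<And>t u. 0 \<le> t \<Longrightarrow> H (t *\<^sub>R u) = t * H u" and sub: "\<And>u v. H (u + v) \<le> H u + H v"
    using assms by (auto simp: sublinear_def)
  have H0: "H 0 = 0" using hom[of 0 0] by simp
  define C where "C = (\<Sum>b\<in>Basis. \<bar>H b\<bar> + \<bar>H (- b)\<bar>)"
  have sum: "H (sum g A) \<le> (\<Sum>a\<in>A. H (g a))" if "finite A" for g :: "'a \<Rightarrow> 'a" and A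
    using that
  proof (induction A)
    case (insert x F)
    then show ?case using sub[of "g x" "sum g F"] by simp
  qed (simp add: H0)
  have "H u \<le> C * norm u" for u
  proof -
    have "H u = H (\<Sum>b\<in>Basis. (u \<bullet> b) *\<^sub>R b)" by (simp add: euclidean_representation)
    also have "\<dots> \<le> (\<Sum>b\<in>Basis. H ((u \<bullet> b) *\<^sub>R b))" by (rule sum) simp
    also have "\<dots> \<le> (\<Sum>b\<in>Basis. (\<bar>H b\<bar> + \<bar>H (- b)\<bar>) * norm u)"
    proof (rule sum_mono)
      fix b :: 'a assume b: "b \<in> Basis"
      have "H ((u \<bullet> b) *\<^sub>R b) \<le> \<bar>u \<bullet> b\<bar> * (\<bar>H b\<bar> + \<bar>H (- b)\<bar>)"
      proof (cases "0 \<le> u \<bullet> b")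
        case True
        then show ?thesis by (simp add: hom mult_left_mono)
      next
        case False
        then have "H ((u \<bullet> b) *\<^sub>R b) = \<bar>u \<bullet> b\<bar> * H (- b)"
          using hom[of "- (u \<bullet> b)" "- b"] by simp
        then show ?thesis by (simp add: mult_left_mono)
      qed
      also have "\<dots> \<le> (\<bar>H b\<bar> + \<bar>H (- b)\<bar>) * norm u"
        using Basis_le_norm[OF b, of u] by (simp add: mult.commute[of "\<bar>u \<bullet> b\<bar>"] mult_left_mono)
      finally show "H ((u \<bullet> b) *\<^sub>R b) \<le> (\<bar>H b\<bar> + \<bar>H (- b)\<bar>) * norm u" .
    qed
    finally show ?thesis by (simp add: C_def sum_distrib_right)
  qed
  moreover have "0 \<le> C" unfolding C_def by (intro sum_nonneg) simp
  ultimately show thesis using that by blast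
qed

lemma sublinear_lipschitz:
  fixes H :: "'a::euclidean_space \<Rightarrow> real"
  assumes "sublinear H"
  obtains C where "0 \<le> C" "\<And>u v. \<bar>H u - H v\<bar> \<le> C * norm (u - v)"
proof -
  obtain C where C: "0 \<le> C" "\<And>u. H u \<le> C * norm u" using sublinear_bound[OF assms] by blast
  have "\<bar>H u - H v\<bar> \<le> C * norm (u - v)" for u v
    using sublinear_diff_le[OF assms, of u v] sublinear_diff_le[OF assms, of v u]
      C(2)[of "u - v"] C(2)[of "v - u"]
    by (simp add: norm_minus_commute abs_le_iff)
  with C(1) that show thesis by blast
qed

lemma continuous_on_sublinear:
  fixes H :: "'a::euclidean_space \<Rightarrow> real"
  assumes "sublinear H"
  shows "continuous_on S H"
proof -
  obtain C where C: "0 \<le> C" "\<And>u v. \<bar>H u - H v\<bar> \<le> C * norm (u - v)"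
    using sublinear_lipschitz[OF assms] by blast
  then have "C-lipschitz_on S H"
    by (intro lipschitz_onI) (auto simp: dist_norm)
  then show ?thesis by (rule lipschitz_on_continuous_on)
qed

definition body_of_support :: "('a::real_inner \<Rightarrow> real) \<Rightarrow> 'a set" where
  "body_of_support H = {x. \<forall>u. u \<bullet> x \<le> H u}"

text \<open>A finite-dimensional Hahn-Banach theorem: the epigraph of \<open>H\<close> is a closed convex cone, and a
  hyperplane that separates it from the point \<open>(v, t)\<close> below the graph is not vertical, so it is the
  graph of a linear functional dominated by \<open>H\<close>.\<close>

lemma sublinear_supporting_point:
  fixes H :: "'a::euclidean_space \<Rightarrow> real"
  assumes H: "sublinear H" and t: "t < H v"
  obtains x where "x \<in> body_of_support H" "t < v \<bullet> x"
proof -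
  have hom: "\<And>t u. 0 \<le> t \<Longrightarrow> H (t *\<^sub>R u) = t * H u" and sub: "\<And>u v. H (u + v) \<le> H u + H v"
    using H by (auto simp: sublinear_def)
  define E where "E = {p::'a \<times> real. H (fst p) \<le> snd p}"
  have E0: "(0, 0) \<in> E" using hom[of 0 0] by (simp add: E_def)
  have cone: "r *\<^sub>R p \<in> E" if "p \<in> E" "0 \<le> r" for p r
    using that by (auto simp: E_def hom mult_left_mono)
  have "convex E"
  proof (rule convexI)
    fix p q :: "'a \<times> real" and a b :: real
    assume pq: "p \<in> E" "q \<in> E" and ab: "0 \<le> a" "0 \<le> b" "a + b = 1"
    have "H (fst (a *\<^sub>R p + b *\<^sub>R q)) \<le> H (fst (a *\<^sub>R p)) + H (fst (b *\<^sub>R q))"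
      using sub by simp
    also have "\<dots> \<le> snd (a *\<^sub>R p) + snd (b *\<^sub>R q)"
      using cone[OF pq(1) ab(1)] cone[OF pq(2) ab(2)] by (simp add: E_def add_mono)
    finally show "a *\<^sub>R p + b *\<^sub>R q \<in> E" by (simp add: E_def)
  qed
  moreover have "closed E"
  proof -
    have "continuous_on UNIV (\<lambda>p::'a \<times> real. H (fst p))"
      by (intro continuous_on_compose2[OF continuous_on_sublinear[OF H, of UNIV]] continuous_intros) auto
    then show ?thesis
      unfolding E_def by (intro closed_Collect_le continuous_intros)
  qed
  moreover have "(v, t) \<notin> E" using t by (simp add: E_def)
  ultimately obtain q c where q: "q \<bullet> (v, t) < c" "\<forall>p\<in>E. c < q \<bullet> p"
    using separating_hyperplane_closed_point[of E "(v, t)"] by blast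
  obtain a b where qab: "q = (a, b)" by (cases q)
  have c: "c < 0" using bspec[OF q(2) E0] by (simp add: zero_prod_def[symmetric])
  have pos: "0 \<le> q \<bullet> p" if "p \<in> E" for p
  proof (rule ccontr)
    assume neg: "\<not> 0 \<le> q \<bullet> p"
    then have "(c / (q \<bullet> p)) *\<^sub>R p \<in> E"
      using cone[OF that] c by (simp add: zero_le_divide_iff)
    then have "c < q \<bullet> ((c / (q \<bullet> p)) *\<^sub>R p)"
      using q(2) by blast
    then show False using neg by simp
  qed
  have pos_ab: "0 \<le> a \<bullet> u + b * s" if "H u \<le> s" for u s
    using pos[of "(u, s)"] that by (simp add: E_def qab)
  have neg_ab: "a \<bullet> v + b * t < 0" using q(1) c by (simp add: qab)
  have b: "0 < b"
  proof (rule ccontr)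
    assume "\<not> 0 < b"
    then have "b * H v \<le> b * t" using t by (simp add: mult_left_mono_neg)
    then show False using pos_ab[of v "H v"] neg_ab by simp
  qed
  define x where "x = - (a /\<^sub>R b)"
  have eq: "u \<bullet> x = - (a \<bullet> u) / b" for u
    by (simp add: x_def inner_commute divide_inverse mult.commute)
  have "x \<in> body_of_support H"
    unfolding body_of_support_def
  proof (intro CollectI allI)
    show "u \<bullet> x \<le> H u" for u
      using pos_ab[OF order_refl, of u] b by (simp add: eq field_simps)
  qed
  moreover have "t < v \<bullet> x"
    using neg_ab b by (simp add: eq field_simps)
  ultimately show thesis using that by blast
qed

lemma body_of_support_in_convex_bodies:
  fixes H :: "'a::euclidean_space \<Rightarrow> real"
  assumes H: "sublinear H"
  shows "body_of_support H \<in> convex_bodies"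
proof -
  have "body_of_support H \<noteq> {}"
    using sublinear_supporting_point[OF H, of "H 0 - 1" 0] by fastforce
  moreover have "convex (body_of_support H)"
  proof -
    have "body_of_support H = (\<Inter>u. {x. u \<bullet> x \<le> H u})" by (auto simp: body_of_support_def)
    then show ?thesis by (auto intro: convex_INT convex_halfspace_le)
  qed
  moreover have "closed (body_of_support H)"
  proof -
    have "body_of_support H = (\<Inter>u. {x. u \<bullet> x \<le> H u})" by (auto simp: body_of_support_def)
    then show ?thesis by (auto intro: closed_INT closed_halfspace_le)
  qed
  moreover have "bounded (body_of_support H)"
  proof -
    obtain C where C: "0 \<le> C" "\<And>u. H u \<le> C * norm u" using sublinear_bound[OF H] by blast
    have "norm x \<le> C" if "x \<in> body_of_support H" for x
    proof (cases "x = 0")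
      case False
      have "x \<bullet> x \<le> C * norm x"
        using that C(2)[of x] unfolding body_of_support_def by (metis (mono_tags) mem_Collect_eq order_trans)
      then show ?thesis using False by (simp add: dot_square_norm power2_eq_square)
    qed (use C in simp)
    then show ?thesis by (auto simp: bounded_iff)
  qed
  ultimately show ?thesis
    by (simp add: convex_bodies_iff compact_eq_bounded_closed)
qed

lemma support_function_body_of_support:
  fixes H :: "'a::euclidean_space \<Rightarrow> real"
  assumes H: "sublinear H"
  shows "support_function (body_of_support H) u = H u"
proof (rule order_antisym)
  note body = body_of_support_in_convex_bodies[OF H]
  show "support_function (body_of_support H) u \<le> H u"
    by (rule support_function_attained[OF body, of u]) (simp add: body_of_support_def)
  show "H u \<le> support_function (body_of_support H) u"
  proof (rule ccontr)
    assume "\<not> H u \<le> support_function (body_of_support H) u"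
    then obtain x where "x \<in> body_of_support H" "support_function (body_of_support H) u < u \<bullet> x"
      using sublinear_supporting_point[OF H] by (metis not_le)
    then show False using inner_le_support_function[OF body, of x u] by simp
  qed
qed

section \<open>The Hausdorff distance in terms of support functions\<close>

text \<open>If \<open>y\<close> is the point of \<open>L\<close> closest to \<open>x\<close>, then in the direction \<open>u\<close> of \<open>x - y\<close> the
  support function of \<open>L\<close> is attained at \<open>y\<close>, whence \<open>|x - y| = u\<bullet>x - u\<bullet>y\<close> is at most the
  difference of the support functions at \<open>u\<close>.\<close>

lemma infdist_le_of_support_function_le:
  fixes K L :: "'a::euclidean_space set"
  assumes K: "K \<in> convex_bodies" and L: "L \<in> convex_bodies" and d: "0 \<le> d"
    and le: "\<And>u. norm u = 1 \<Longrightarrow> support_function K u \<le> support_function L u + d"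
    and x: "x \<in> K"
  shows "infdist x L \<le> d"
proof -
  define y where "y = closest_point L x"
  have L': "closed L" "convex L" "L \<noteq> {}" using L by (auto simp: convex_bodies_iff compact_imp_closed)
  have y: "y \<in> L" using L' by (simp add: y_def closest_point_in_set)
  have "norm (x - y) \<le> d"
  proof (cases "x = y")
    case False
    define u where "u = sgn (x - y)"
    have u: "norm u = 1" using False by (simp add: u_def norm_sgn)
    have "u \<bullet> z \<le> u \<bullet> y" if "z \<in> L" for z
    proof -
      have "(x - y) \<bullet> (z - y) \<le> 0"
        using closest_point_dot[OF L'(2,1) that, of x] by (simp add: y_def)
      then have "u \<bullet> (z - y) \<le> 0"
        by (simp add: u_def sgn_div_norm divide_inverse mult_nonneg_nonpos)
      then show ?thesis by (simp add: inner_diff_right)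
    qed
    then have "support_function L u = u \<bullet> y"
      using support_function_eqI[OF L y refl] by blast
    moreover have "u \<bullet> (x - y) = norm (x - y)"
      using False by (simp add: u_def sgn_div_norm dot_square_norm power2_eq_square)
    ultimately show ?thesis
      using le[OF u] inner_le_support_function[OF K x, of u] by (simp add: inner_diff_right)
  qed (use d in simp)
  then show ?thesis
    using infdist_le[OF y, of x] by (simp add: dist_norm)
qed

lemma hausdorff_distance_le_of_support_function:
  fixes K L :: "'a::euclidean_space set"
  assumes K: "K \<in> convex_bodies" and L: "L \<in> convex_bodies" and d: "0 \<le> d"
    and le: "\<And>u. norm u = 1 \<Longrightarrow> \<bar>support_function K u - support_function L u\<bar> \<le> d"
  shows "hausdorff_distance K L \<le> d"
proof -
  have "K \<noteq> {}" "L \<noteq> {}" "bounded K" "bounded L"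
    using K L by (auto simp: convex_bodies_iff compact_imp_bounded)
  moreover have "infdist x L \<le> d" if "x \<in> K" for x
    by (rule infdist_le_of_support_function_le[OF K L d _ that]) (use le in \<open>fastforce simp: abs_le_iff\<close>)
  moreover have "infdist x K \<le> d" if "x \<in> L" for x
    by (rule infdist_le_of_support_function_le[OF L K d _ that]) (use le in \<open>fastforce simp: abs_le_iff\<close>)
  ultimately show ?thesis by (simp add: hausdorff_distance_le_iff)
qed

lemma convex_bodies_eqI:
  fixes K L :: "'a::euclidean_space set"
  assumes "K \<in> convex_bodies" "L \<in> convex_bodies"
    and "\<And>u. norm u = 1 \<Longrightarrow> support_function K u = support_function L u"
  shows "K = L"
proof -
  have "hausdorff_distance K L \<le> 0"
    by (rule hausdorff_distance_le_of_support_function) (use assms in auto)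
  then show ?thesis
    using assms hausdorff_distance_nonneg[of K L] hausdorff_distance_eq_0_iff[of K L]
    by (auto simp: convex_bodies_iff)
qed


section \<open>Continuous Minkowski additive maps\<close>

locale continuous_additive_map =
  fixes f :: "'a::euclidean_space set \<Rightarrow> 'b::euclidean_space"
  assumes continuous: "continuous_map hausdorff.mtopology euclidean f"
    and additive: "\<And>K L. K \<in> convex_bodies \<Longrightarrow> L \<in> convex_bodies \<Longrightarrow> f (K + L) = f K + f L"
begin

lemma tendsto_of_hausdorff:
  assumes K: "\<And>i. K i \<in> convex_bodies" and L: "L \<in> convex_bodies"
    and lim: "(\<lambda>i. hausdorff_distance (K i) L) \<longlonglongrightarrow> 0"
  shows "(\<lambda>i. f (K i)) \<longlonglongrightarrow> f L"
proof -
  have "limitin hausdorff.mtopology K L sequentially"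
    unfolding hausdorff.limit_metric_sequentially
  proof (intro conjI allI impI)
    fix e :: real assume "0 < e"
    then have "\<forall>\<^sub>F i in sequentially. hausdorff_distance (K i) L < e"
      using order_tendstoD(2)[OF lim] by blast
    then show "\<exists>N. \<forall>n\<ge>N. K n \<in> convex_bodies \<and> hausdorff_distance (K n) L < e"
      using K by (auto simp: eventually_sequentially)
  qed (fact L)
  then have "limitin euclidean (f \<circ> K) (f L) sequentially"
    by (rule continuous_map_limit[OF continuous])
  then show ?thesis by (simp add: o_def limitin_canonical_iff)
qed

lemma tendsto_of_support_function:
  assumes K: "\<And>i. K i \<in> convex_bodies" and L: "L \<in> convex_bodies"
    and le: "\<And>i u. norm u = 1 \<Longrightarrow> \<bar>support_function (K i) u - support_function L u\<bar> \<le> d i"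
    and lim: "d \<longlonglongrightarrow> 0"
  shows "(\<lambda>i. f (K i)) \<longlonglongrightarrow> f L"
proof (rule tendsto_of_hausdorff[OF K L])
  obtain b :: 'a where b: "norm b = 1" using norm_Basis nonempty_Basis by blast
  have d: "0 \<le> d i" for i using le[OF b, of i] by linarith
  show "(\<lambda>i. hausdorff_distance (K i) L) \<longlonglongrightarrow> 0"
    using lim
  proof (rule Lim_null_comparison[rotated], intro always_eventually allI)
    show "norm (hausdorff_distance (K i) L) \<le> d i" for i
      using hausdorff_distance_le_of_support_function[OF K L d le] hausdorff_distance_nonneg[of "K i" L]
      by simp
  qed
qed

lemma map_zero: "f {0} = 0"
proof -
  have "{0} + {0} = ({0} :: 'a set)" by (simp flip: set_zero)
  then show ?thesis using additive[of "{0}" "{0}"] by simp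
qed

text \<open>By additivity the claim holds for rational \<open>t\<close>; the case of real \<open>t\<close> follows by continuity.\<close>

lemma map_scaleR:
  assumes K: "K \<in> convex_bodies" and t: "0 \<le> t"
  shows "f ((*\<^sub>R) t ` K) = t *\<^sub>R f K"
proof -
  define g where "g s = f ((*\<^sub>R) s ` K)" for s
  have g_add: "g (s + t) = g s + g t" if "0 \<le> s" "0 \<le> t" for s t
  proof -
    have "(*\<^sub>R) (s + t) ` K = (*\<^sub>R) s ` K + (*\<^sub>R) t ` K"
      using that K
      by (intro convex_bodies_eqI)
         (auto simp: convex_bodies_scaleR convex_bodies_plus support_function_plus
            support_function_scaleR distrib_right)
    then show ?thesis by (simp add: g_def additive convex_bodies_scaleR K)
  qed
  have g0: "g 0 = 0" using g_add[of 0 0] by simp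
  have g1: "g 1 = f K" by (simp add: g_def)
  have g_nat: "g (real n * s) = real n *\<^sub>R g s" if "0 \<le> s" for n s
    using that g_add[of s "real _ * s"] by (induction n) (simp_all add: g0 distrib_right scaleR_add_left)
  have g_rat: "g (real n / real (Suc m)) = (real n / real (Suc m)) *\<^sub>R f K" for n m
  proof -
    have "real (Suc m) *\<^sub>R g (real n / real (Suc m)) = g (real n)"
      using g_nat[of "real n / real (Suc m)" "Suc m"] by (simp del: of_nat_Suc)
    also have "\<dots> = real n *\<^sub>R f K" using g_nat[of 1 n] by (simp add: g1)
    finally have "(1 / real (Suc m)) *\<^sub>R (real (Suc m) *\<^sub>R g (real n / real (Suc m)))
        = (1 / real (Suc m)) *\<^sub>R real n *\<^sub>R f K" by (rule arg_cong)
    then show ?thesis by (simp del: of_nat_Suc)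
  qed
  \<comment> \<open>The rationals \<open>q m\<close> approximate \<open>t\<close> from below with error at most \<open>1 / (m + 1)\<close>.\<close>
  define q where "q m = real (nat \<lfloor>real (Suc m) * t\<rfloor>) / real (Suc m)" for m
  have q: "\<bar>q m - t\<bar> \<le> 1 / real (Suc m)" for m
  proof -
    have "real (Suc m) * t - 1 \<le> real (nat \<lfloor>real (Suc m) * t\<rfloor>)"
         "real (nat \<lfloor>real (Suc m) * t\<rfloor>) \<le> real (Suc m) * t"
      using t by (auto simp: le_floor_iff)
    then have "\<bar>real (nat \<lfloor>real (Suc m) * t\<rfloor>) - real (Suc m) * t\<bar> / real (Suc m) \<le> 1 / real (Suc m)"
      by (intro divide_right_mono) (simp_all only: abs_le_iff of_nat_0_le_iff, linarith)
    moreover have "q m - t = (real (nat \<lfloor>real (Suc m) * t\<rfloor>) - real (Suc m) * t) / real (Suc m)"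
      by (simp add: q_def diff_divide_distrib del: of_nat_Suc)
    ultimately show ?thesis by (simp add: abs_divide del: of_nat_Suc)
  qed
  have q0: "0 \<le> q m" for m by (simp add: q_def)
  have q_lim: "q \<longlonglongrightarrow> t"
  proof -
    have "(\<lambda>m. q m - t) \<longlonglongrightarrow> 0"
      using q LIMSEQ_inverse_real_of_nat
      by (intro Lim_null_comparison[of "\<lambda>m. q m - t" "\<lambda>m. 1 / real (Suc m)"])
         (simp_all add: inverse_eq_divide)
    then show ?thesis by (simp add: LIM_zero_iff)
  qed
  obtain C where C: "0 \<le> C" "\<And>u v. \<bar>support_function K u - support_function K v\<bar> \<le> C * norm (u - v)"
    using sublinear_lipschitz[OF sublinear_support_function[OF K]] by blast
  have K0: "support_function K 0 = 0"
    using sublinear_support_function[OF K] unfolding sublinear_def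
    by (metis mult_zero_left order_refl scaleR_zero_left)
  have "(\<lambda>m. f ((*\<^sub>R) (q m) ` K)) \<longlonglongrightarrow> f ((*\<^sub>R) t ` K)"
  proof (rule tendsto_of_support_function)
    show "(\<lambda>m. \<bar>q m - t\<bar> * C) \<longlonglongrightarrow> 0"
      using q_lim by (intro tendsto_eq_intros) (auto intro: tendsto_eq_intros q_lim)
    show "\<bar>support_function ((*\<^sub>R) (q m) ` K) u - support_function ((*\<^sub>R) t ` K) u\<bar> \<le> \<bar>q m - t\<bar> * C"
      if "norm u = 1" for m u
    proof -
      have "support_function ((*\<^sub>R) (q m) ` K) u - support_function ((*\<^sub>R) t ` K) u
          = (q m - t) * support_function K u"
        by (simp add: support_function_scaleR K q0 t left_diff_distrib)
      then show ?thesis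
        using C(2)[of u 0] that by (simp add: abs_mult K0 mult_left_mono)
    qed
  qed (simp_all add: convex_bodies_scaleR K)
  moreover have "(\<lambda>m. f ((*\<^sub>R) (q m) ` K)) = (\<lambda>m. q m *\<^sub>R f K)"
    using g_rat by (simp add: q_def fun_eq_iff flip: g_def del: of_nat_Suc)
  moreover have "(\<lambda>m. q m *\<^sub>R f K) \<longlonglongrightarrow> t *\<^sub>R f K"
    by (intro tendsto_intros q_lim)
  ultimately show ?thesis using LIMSEQ_unique by metis
qed

end

lemma convex_bodies_sum:
  fixes B :: "'i \<Rightarrow> 'a::euclidean_space set"
  assumes "finite A" "\<And>y. y \<in> A \<Longrightarrow> B y \<in> convex_bodies"
  shows "(\<Sum>y\<in>A. B y) \<in> convex_bodies"
  using assms by (induction A) (simp_all add: convex_bodies_plus)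

lemma support_function_sum:
  fixes B :: "'i \<Rightarrow> 'a::euclidean_space set"
  assumes "finite A" "\<And>y. y \<in> A \<Longrightarrow> B y \<in> convex_bodies"
  shows "support_function (\<Sum>y\<in>A. B y) u = (\<Sum>y\<in>A. support_function (B y) u)"
  using assms
  by (induction A) (simp_all add: support_function_plus convex_bodies_sum)

lemma (in continuous_additive_map) map_sum:
  assumes "finite A" "\<And>y. y \<in> A \<Longrightarrow> B y \<in> convex_bodies"
  shows "f (\<Sum>y\<in>A. B y) = (\<Sum>y\<in>A. f (B y))"
  using assms by (induction A) (simp_all add: additive convex_bodies_sum map_zero)

lemma (in finite_measure)
  fixes g :: "'b \<Rightarrow> 'c::{banach, second_countable_topology}"
  assumes s: "simple_function M s"
  shows integrable_comp_simple_function: "integrable M (\<lambda>x. g (s x))"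
    and integral_comp_simple_function:
      "(\<integral>x. g (s x) \<partial>M) = (\<Sum>y\<in>s ` space M. measure M (s -` {y} \<inter> space M) *\<^sub>R g y)"
proof -
  have fin: "finite (s ` space M)" using s by (rule simple_functionD)
  have meas: "s -` {y} \<inter> space M \<in> sets M" for y
    using s by (rule simple_functionD)
  have eq: "g (s x) = (\<Sum>y\<in>s ` space M. indicat_real (s -` {y} \<inter> space M) x *\<^sub>R g y)"
    if "x \<in> space M" for x
  proof -
    have "(\<Sum>y\<in>s ` space M. indicat_real (s -` {y} \<inter> space M) x *\<^sub>R g y)
        = (\<Sum>y\<in>s ` space M. if s x = y then g y else 0)"
      using that by (intro sum.cong) (auto simp: indicator_def)
    then show ?thesis using fin that by simp
  qed
  have int: "integrable M (\<lambda>x. indicat_real (s -` {y} \<inter> space M) x *\<^sub>R g y)" for y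
    using meas by (intro integrable_scaleR_left impI integrable_real_indicator)
      (simp_all add: emeasure_finite less_top[symmetric])
  show "integrable M (\<lambda>x. g (s x))"
    by (subst Bochner_Integration.integrable_cong[OF refl eq])
       (auto intro!: Bochner_Integration.integrable_sum int)
  show "(\<integral>x. g (s x) \<partial>M) = (\<Sum>y\<in>s ` space M. measure M (s -` {y} \<inter> space M) *\<^sub>R g y)"
    by (subst Bochner_Integration.integral_cong[OF refl eq])
       (simp_all add: Bochner_Integration.integral_sum int meas
          integral_scaleR_left integrable_real_indicator emeasure_finite less_top[symmetric])
qed

lemma (in continuous_additive_map) continuous_on_comp_body_family:
  assumes B: "\<And>w. w \<in> S \<Longrightarrow> B w \<in> convex_bodies"
    and lip: "\<And>u w w'. norm u = 1 \<Longrightarrow> w \<in> S \<Longrightarrow> w' \<in> S \<Longrightarrow>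
       \<bar>support_function (B w) u - support_function (B w') u\<bar> \<le> C * dist w w'"
  shows "continuous_on S (\<lambda>w::'c::metric_space. f (B w))"
  unfolding continuous_on_sequentially
proof (intro allI ballI impI)
  fix x :: "nat \<Rightarrow> 'c" and a assume *: "a \<in> S" "(\<forall>n. x n \<in> S) \<and> x \<longlonglongrightarrow> a"
  have "(\<lambda>n. f (B (x n))) \<longlonglongrightarrow> f (B a)"
  proof (rule tendsto_of_support_function)
    show "(\<lambda>n. C * dist (x n) a) \<longlonglongrightarrow> 0"
      using * by (intro tendsto_mult_right_zero) (simp flip: tendsto_dist_iff)
  qed (use * B lip in auto)
  then show "((\<lambda>w. f (B w)) \<circ> x) \<longlonglongrightarrow> f (B a)" by (simp add: o_def)
qed

text \<open>The identity of the ball is a limit of simple functions \<open>s i\<close>.  Replacing \<open>w\<close> by \<open>s i w\<close> turns the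
  integral of support functions into the support function of a finite Minkowski combination
  \<open>Li i\<close>, on which \<open>f\<close> is known; the Lipschitz condition makes the support functions converge
  uniformly on the unit sphere, so that continuity of \<open>f\<close> applies.  The family is
  controlled on the ball of twice the radius because the approximating simple functions satisfy only
  \<open>|s i w| \<le> 2 |w|\<close>.\<close>

lemma (in continuous_additive_map) map_integral:
  fixes M :: "'c::euclidean_space measure" and B :: "'c \<Rightarrow> 'a set"
  assumes M: "finite_measure M" and sets_M: "sets M = sets (restrict_space borel (cball 0 R))"
    and B: "\<And>w. w \<in> cball 0 (2 * R) \<Longrightarrow> B w \<in> convex_bodies"
    and lip: "\<And>u w w'. norm u = 1 \<Longrightarrow> w \<in> cball 0 (2 * R) \<Longrightarrow> w' \<in> cball 0 (2 * R) \<Longrightarrow>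
       \<bar>support_function (B w) u - support_function (B w') u\<bar> \<le> C * dist w w'"
    and L: "L \<in> convex_bodies"
    and int_L: "\<And>u. norm u = 1 \<Longrightarrow> support_function L u = (\<integral>w. support_function (B w) u \<partial>M)"
  shows "f L = (\<integral>w. f (B w) \<partial>M)"
proof -
  interpret finite_measure M by (fact M)
  have sp: "space M = cball 0 R"
    using sets_eq_imp_space_eq[OF sets_M] by (simp add: space_restrict_space)
  have meas: "g \<in> borel_measurable M" if "continuous_on (cball 0 R) g"
    for g :: "'c \<Rightarrow> 'd::topological_space"
    using borel_measurable_continuous_on_restrict[OF that] measurable_cong_sets[OF sets_M refl] by blast
  have id_M: "(\<lambda>x. x) \<in> borel_measurable M" by (intro meas continuous_intros)
  obtain s where s: "\<And>i. simple_function M (s i)"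
      "\<And>x. x \<in> space M \<Longrightarrow> (\<lambda>i. s i x) \<longlonglongrightarrow> x"
      "\<And>i x. x \<in> space M \<Longrightarrow> dist (s i x) 0 \<le> 2 * dist x 0"
    using borel_measurable_implies_sequence_metric[OF id_M, of 0] by blast
  have s2: "s i x \<in> cball 0 (2 * R)" and s1: "x \<in> cball 0 (2 * R)" if "x \<in> space M" for i x
  proof -
    have "norm x \<le> R" using that by (simp add: sp)
    then show "s i x \<in> cball 0 (2 * R)" "x \<in> cball 0 (2 * R)"
      using s(3)[OF that, of i] norm_ge_zero[of x] by (auto simp: dist_norm simp del: norm_ge_zero)
  qed
  have dist_s: "norm (C * dist (s i x) x) \<le> \<bar>C\<bar> * (3 * R)" if x: "x \<in> space M" for i x
  proof -
    have "dist (s i x) x \<le> dist (s i x) 0 + dist x 0" by (metis dist_commute dist_triangle)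
    also have "\<dots> \<le> 3 * R" using s2[OF x, of i] x by (simp add: sp dist_norm)
    finally show ?thesis by (simp add: abs_mult mult_left_mono)
  qed
  define m where "m i y = measure M (s i -` {y} \<inter> space M)" for i y
  define Li where "Li i = (\<Sum>y\<in>s i ` space M. (*\<^sub>R) (m i y) ` B y)" for i
  have fin: "finite (s i ` space M)" for i using s(1) by (rule simple_functionD)
  have m0: "0 \<le> m i y" for i y by (simp add: m_def)
  have By: "B y \<in> convex_bodies" if "y \<in> s i ` space M" for i y using that B s2 by blast
  have Li: "Li i \<in> convex_bodies" for i
    unfolding Li_def by (intro convex_bodies_sum fin convex_bodies_scaleR By)
  have hLi: "support_function (Li i) u = (\<integral>x. support_function (B (s i x)) u \<partial>M)" for i u
    unfolding Li_def integral_comp_simple_function[OF s(1), of "\<lambda>y. support_function (B y) u"]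
    using By m0 fin by (simp add: support_function_sum convex_bodies_scaleR support_function_scaleR m_def)
  have fLi: "f (Li i) = (\<integral>x. f (B (s i x)) \<partial>M)" for i
    unfolding Li_def integral_comp_simple_function[OF s(1), of "\<lambda>y. f (B y)"]
    using By m0 fin by (simp add: map_sum convex_bodies_scaleR map_scaleR m_def)
  have cont_h: "continuous_on (cball 0 (2 * R)) (\<lambda>w. support_function (B w) u)" if u: "norm u = 1" for u
  proof -
    have "\<bar>C\<bar>-lipschitz_on (cball 0 (2 * R)) (\<lambda>w. support_function (B w) u)"
    proof (rule lipschitz_onI)
      fix w w' :: 'c assume w: "w \<in> cball 0 (2 * R)" "w' \<in> cball 0 (2 * R)"
      have "C * dist w w' \<le> \<bar>C\<bar> * dist w w'" by (intro mult_right_mono) auto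
      then show "dist (support_function (B w) u) (support_function (B w') u) \<le> \<bar>C\<bar> * dist w w'"
        using lip[OF u w] by (simp add: dist_real_def)
    qed simp
    then show ?thesis by (rule lipschitz_on_continuous_on)
  qed
  have sub: "cball 0 R \<subseteq> (cball 0 (2 * R) :: 'c set)" using s1 by (auto simp: sp)
  have bdd: "\<exists>b. \<forall>x\<in>cball 0 (2 * R). norm (g x) \<le> b" if "continuous_on (cball 0 (2 * R)) g"
    for g :: "'c \<Rightarrow> 'd::real_normed_vector"
    using compact_imp_bounded[OF compact_continuous_image[OF that compact_cball]]
    by (auto simp: bounded_iff)
  have int_h: "integrable M (\<lambda>w. support_function (B w) u)" if u: "norm u = 1" for u
  proof -
    obtain b where "\<forall>x\<in>cball 0 (2 * R). norm (support_function (B x) u) \<le> b"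
      using bdd[OF cont_h[OF u]] by blast
    then show ?thesis
      using s1 by (intro integrable_const_bound[where B = b] AE_I2 meas
            continuous_on_subset[OF cont_h[OF u] sub]) auto
  qed
  have lim_s: "(\<lambda>i. \<integral>x. C * dist (s i x) x \<partial>M) \<longlonglongrightarrow> (\<integral>x. 0 \<partial>M)"
  proof (rule integral_dominated_convergence)
    show "(\<lambda>x. C * dist (s i x) x) \<in> borel_measurable M" for i
      using borel_measurable_simple_function[OF s(1), of i] id_M by measurable
    show "integrable M (\<lambda>x. \<bar>C\<bar> * (3 * R))" by simp
    show "AE x in M. (\<lambda>i. C * dist (s i x) x) \<longlonglongrightarrow> 0"
    proof (rule AE_I2)
      fix x assume "x \<in> space M"
      then show "(\<lambda>i. C * dist (s i x) x) \<longlonglongrightarrow> 0"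
        using s(2) by (intro tendsto_mult_right_zero) (simp flip: tendsto_dist_iff)
    qed
    show "AE x in M. norm (C * dist (s i x) x) \<le> \<bar>C\<bar> * (3 * R)" for i
      by (intro AE_I2 dist_s)
  qed simp
  have "(\<lambda>i. f (Li i)) \<longlonglongrightarrow> f L"
  proof (rule tendsto_of_support_function[OF Li L])
    show "(\<lambda>i. \<integral>x. C * dist (s i x) x \<partial>M) \<longlonglongrightarrow> 0" using lim_s by simp
    fix i u assume u: "norm (u::'a) = 1"
    have int_s: "integrable M (\<lambda>x. support_function (B (s i x)) u)"
      by (rule integrable_comp_simple_function[OF s(1), of "\<lambda>y. support_function (B y) u"])
    have "\<bar>support_function (Li i) u - support_function L u\<bar>
        = \<bar>\<integral>x. support_function (B (s i x)) u - support_function (B x) u \<partial>M\<bar>"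
      by (simp add: hLi int_L[OF u] int_s int_h[OF u])
    also have "\<dots> \<le> (\<integral>x. C * dist (s i x) x \<partial>M)"
    proof (rule integral_abs_bound_integral)
      show "integrable M (\<lambda>x. support_function (B (s i x)) u - support_function (B x) u)"
        by (intro Bochner_Integration.integrable_diff int_s int_h[OF u])
      show "integrable M (\<lambda>x. C * dist (s i x) x)"
      proof (rule integrable_const_bound[where B = "\<bar>C\<bar> * (3 * R)"])
        show "AE x in M. norm (C * dist (s i x) x) \<le> \<bar>C\<bar> * (3 * R)"
          by (intro AE_I2 dist_s)
        show "(\<lambda>x. C * dist (s i x) x) \<in> borel_measurable M"
          using borel_measurable_simple_function[OF s(1), of i] id_M by measurable
      qed
      show "\<bar>support_function (B (s i x)) u - support_function (B x) u\<bar> \<le> C * dist (s i x) x"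
        if "x \<in> space M" for x using lip[OF u s2[OF that] s1[OF that]] .
    qed
    finally show "\<bar>support_function (Li i) u - support_function L u\<bar> \<le> (\<integral>x. C * dist (s i x) x \<partial>M)" .
  qed
  moreover have "(\<lambda>i. f (Li i)) \<longlonglongrightarrow> (\<integral>w. f (B w) \<partial>M)"
  proof -
    have cont_f: "continuous_on (cball 0 (2 * R)) (\<lambda>w. f (B w))"
      by (rule continuous_on_comp_body_family[OF B lip])
    obtain b where b: "\<forall>x\<in>cball 0 (2 * R). norm (f (B x)) \<le> b" using bdd[OF cont_f] by blast
    show ?thesis
      unfolding fLi
    proof (rule integral_dominated_convergence)
      show "(\<lambda>w. f (B w)) \<in> borel_measurable M"
        by (rule meas[OF continuous_on_subset[OF cont_f sub]])
      show "(\<lambda>x. f (B (s i x))) \<in> borel_measurable M" for i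
        using integrable_comp_simple_function[OF s(1), of "\<lambda>y. f (B y)"] by auto
      show "integrable M (\<lambda>x. b)" by simp
      show "AE x in M. (\<lambda>i. f (B (s i x))) \<longlonglongrightarrow> f (B x)"
      proof (rule AE_I2)
        fix x assume x: "x \<in> space M"
        show "(\<lambda>i. f (B (s i x))) \<longlonglongrightarrow> f (B x)"
          by (rule continuous_on_tendsto_compose[OF cont_f s(2)[OF x] s1[OF x]]) (use s2[OF x] in auto)
      qed
      show "AE x in M. norm (f (B (s i x))) \<le> b" for i
        using b s2 by (intro AE_I2) blast
    qed
  qed
  ultimately show ?thesis by (rule LIMSEQ_unique)
qed


section \<open>Smoothing of convex bodies\<close>

lemma lborel_distr_orthogonal_transformation:
  fixes T :: "'a::euclidean_space \<Rightarrow> 'a"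
  assumes T: "orthogonal_transformation T"
  shows "distr lborel borel T = lborel"
  using borel_measurable_orthogonal_transformation[OF T]
  by (intro measure_eqI) (simp_all add: emeasure_distr emeasure_lborel_orthogonal_vimage[OF T])

lemma integral_lborel_translate:
  fixes g :: "'a::euclidean_space \<Rightarrow> 'b::{banach, second_countable_topology}"
  assumes [measurable]: "g \<in> borel_measurable borel"
  shows "(\<integral>x. g (a + x) \<partial>lborel) = (\<integral>x. g x \<partial>lborel)"
proof -
  have "(\<integral>x. g x \<partial>lborel) = (\<integral>x. g x \<partial>distr lborel borel ((+) a))"
    by (simp add: lborel_distr_plus)
  also have "\<dots> = (\<integral>x. g (a + x) \<partial>lborel)"
    by (subst integral_distr) auto
  finally show ?thesis ..
qed

text \<open>The function \<open>G(u, r) = \<integral> h(u + r z) dP(z)\<close> is sublinear in \<open>(u, r)\<close>, and even in \<open>r\<close> since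
  \<open>P\<close> is symmetric.  Being convex and even in \<open>r\<close>, it increases for \<open>r \<ge> 0\<close>, so the triangle
  inequality for \<open>r = |u|\<close> can be used.\<close>

lemma sublinear_smoothing:
  fixes h :: "'a::euclidean_space \<Rightarrow> real"
  assumes P: "prob_space P" and sets_P: "sets P = sets borel" and supp: "AE z in P. norm z \<le> \<epsilon>"
    and sym: "distr P borel uminus = P" and h: "sublinear h"
  shows "sublinear (\<lambda>u. \<integral>z. h (u + norm u *\<^sub>R z) \<partial>P)"
proof -
  interpret prob_space P by (fact P)
  have h_add: "h (u + v) \<le> h u + h v" and h_scale: "0 \<le> t \<Longrightarrow> h (t *\<^sub>R u) = t * h u" for u v t
    using h by (auto simp: sublinear_def)
  note [measurable_cong] = sets_P
  have [measurable]: "h \<in> borel_measurable borel"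
    by (intro borel_measurable_continuous_onI continuous_on_sublinear h)
  obtain C where C: "0 \<le> C" "\<And>u v. \<bar>h u - h v\<bar> \<le> C * norm (u - v)"
    using sublinear_lipschitz[OF h] by blast
  have int: "integrable P (\<lambda>z. h (u + r *\<^sub>R z))" for u r
  proof (rule integrable_const_bound[where B = "\<bar>h u\<bar> + C * (\<bar>r\<bar> * \<epsilon>)"])
    show "AE z in P. norm (h (u + r *\<^sub>R z)) \<le> \<bar>h u\<bar> + C * (\<bar>r\<bar> * \<epsilon>)"
      using supp
    proof eventually_elim
      case (elim z)
      have "\<bar>h (u + r *\<^sub>R z) - h u\<bar> \<le> C * (\<bar>r\<bar> * norm z)" using C(2)[of "u + r *\<^sub>R z" u] by simp
      also have "\<dots> \<le> C * (\<bar>r\<bar> * \<epsilon>)" using elim C(1) by (intro mult_left_mono) auto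
      finally show ?case by simp
    qed
  qed measurable
  define G where "G u r = (\<integral>z. h (u + r *\<^sub>R z) \<partial>P)" for u r
  have G_neg: "G u (- r) = G u r" for u r
  proof -
    have "G u r = (\<integral>z. h (u + r *\<^sub>R z) \<partial>distr P borel uminus)" by (simp add: G_def sym)
    also have "\<dots> = G u (- r)" by (subst integral_distr) (auto simp: G_def)
    finally show ?thesis ..
  qed
  have G_add: "G (u + v) (r + s) \<le> G u r + G v s" for u v r s
  proof -
    have "G (u + v) (r + s) \<le> (\<integral>z. h (u + r *\<^sub>R z) + h (v + s *\<^sub>R z) \<partial>P)"
      unfolding G_def
    proof (rule integral_mono)
      show "h (u + v + (r + s) *\<^sub>R z) \<le> h (u + r *\<^sub>R z) + h (v + s *\<^sub>R z)" for z
        using h_add[of "u + r *\<^sub>R z" "v + s *\<^sub>R z"] by (simp add: algebra_simps)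
    qed (intro int Bochner_Integration.integrable_add)+
    then show ?thesis by (simp add: G_def int)
  qed
  have G_scale: "G (t *\<^sub>R u) (t * r) = t * G u r" if "0 \<le> t" for t u r
  proof -
    have "h (t *\<^sub>R u + (t * r) *\<^sub>R z) = t * h (u + r *\<^sub>R z)" for z
      using h_scale[OF that, of "u + r *\<^sub>R z"] by (simp add: scaleR_add_right)
    then show ?thesis by (simp add: G_def)
  qed
  have G_mono: "G u r \<le> G u s" if "0 \<le> r" "r \<le> s" for u r s
  proof (cases "s = 0")
    case False
    \<comment> \<open>The weight for which \<open>r\<close> is the convex combination of \<open>s\<close> and \<open>- s\<close>.\<close>
    define a where "a = (1 + r / s) / 2"
    have a: "0 \<le> a" "0 \<le> 1 - a" using that False by (auto simp: a_def field_simps)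
    have "r = a * s + (1 - a) * (- s)" using False by (simp add: a_def field_simps)
    moreover have "u = a *\<^sub>R u + (1 - a) *\<^sub>R u" by (simp add: scaleR_left_diff_distrib)
    ultimately have "G u r \<le> G (a *\<^sub>R u) (a * s) + G ((1 - a) *\<^sub>R u) ((1 - a) * (- s))"
      using G_add by metis
    also have "\<dots> = a * G u s + (1 - a) * G u s" unfolding G_scale[OF a(1)] G_scale[OF a(2)] G_neg ..
    finally show ?thesis by (simp add: left_diff_distrib)
  qed (use that in simp)
  show ?thesis
    unfolding sublinear_def G_def[symmetric]
  proof (intro conjI allI impI)
    show "G (u + v) (norm (u + v)) \<le> G u (norm u) + G v (norm v)" for u v
      using G_mono[of "norm (u + v)" "norm u + norm v" "u + v"] G_add[of u v "norm u" "norm v"]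
      by (simp add: norm_triangle_ineq)
    show "G (t *\<^sub>R u) (norm (t *\<^sub>R u)) = t * G u (norm u)" if "0 \<le> t" for t u
      using G_scale[OF that, of u "norm u"] that by simp
  qed
qed

lemma smoothing_close:
  fixes h :: "'a::euclidean_space \<Rightarrow> real"
  assumes P: "prob_space P" and sets_P: "sets P = sets borel" and supp: "AE z in P. norm z \<le> \<epsilon>"
    and h: "continuous_on UNIV h" and C: "0 \<le> C" "\<And>u v. \<bar>h u - h v\<bar> \<le> C * norm (u - v)"
  shows "\<bar>(\<integral>z. h (u + norm u *\<^sub>R z) \<partial>P) - h u\<bar> \<le> C * (norm u * \<epsilon>)"
proof -
  interpret prob_space P by (fact P)
  note [measurable_cong] = sets_P
  have [measurable]: "h \<in> borel_measurable borel" using h by (rule borel_measurable_continuous_onI)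
  have bound: "AE z in P. \<bar>h (u + norm u *\<^sub>R z) - h u\<bar> \<le> C * (norm u * \<epsilon>)"
    using supp
  proof eventually_elim
    case (elim z)
    have "\<bar>h (u + norm u *\<^sub>R z) - h u\<bar> \<le> C * (norm u * norm z)"
      using C(2)[of "u + norm u *\<^sub>R z" u] by simp
    also have "\<dots> \<le> C * (norm u * \<epsilon>)" using elim C(1) by (intro mult_left_mono) auto
    finally show ?case .
  qed
  have int: "integrable P (\<lambda>z. h (u + norm u *\<^sub>R z) - h u)"
    by (rule integrable_const_bound[where B = "C * (norm u * \<epsilon>)"]) (use bound in simp_all)
  then have int': "integrable P (\<lambda>z. h (u + norm u *\<^sub>R z))"
    using Bochner_Integration.integrable_add[OF int, of "\<lambda>_. h u"] by simp
  have "\<bar>(\<integral>z. h (u + norm u *\<^sub>R z) \<partial>P) - h u\<bar> = \<bar>\<integral>z. h (u + norm u *\<^sub>R z) - h u \<partial>P\<bar>"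
    using int' by (simp add: prob_space)
  also have "\<dots> \<le> (\<integral>z. \<bar>h (u + norm u *\<^sub>R z) - h u\<bar> \<partial>P)" by (rule integral_abs_bound)
  also have "\<dots> \<le> (\<integral>z. C * (norm u * \<epsilon>) \<partial>P)"
    using int bound by (intro integral_mono_AE) auto
  finally show ?thesis by (simp add: prob_space)
qed

definition epanechnikov :: "real \<Rightarrow> 'a::euclidean_space \<Rightarrow> real" where
  "epanechnikov \<epsilon> z = max 0 (\<epsilon>\<^sup>2 - (norm z)\<^sup>2)"

text \<open>The mass depends on the dimension of the space, which is passed as a type.\<close>

definition kernel_mass :: "'a::euclidean_space itself \<Rightarrow> real \<Rightarrow> real" where
  "kernel_mass _ \<epsilon> = (\<integral>z. epanechnikov \<epsilon> (z::'a) \<partial>lborel)"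

definition kernel_prob :: "real \<Rightarrow> 'a::euclidean_space measure" where
  "kernel_prob \<epsilon> = density lborel (\<lambda>z. ennreal (epanechnikov \<epsilon> z / kernel_mass TYPE('a) \<epsilon>))"

lemma epanechnikov_nonneg: "0 \<le> epanechnikov \<epsilon> z"
  by (simp add: epanechnikov_def)

lemma epanechnikov_eq_0: "0 \<le> \<epsilon> \<Longrightarrow> \<epsilon> \<le> norm z \<Longrightarrow> epanechnikov \<epsilon> z = 0"
  by (simp add: epanechnikov_def power_mono)

lemma continuous_on_epanechnikov: "continuous_on S (epanechnikov \<epsilon>)"
  unfolding epanechnikov_def by (intro continuous_intros)

lemma borel_measurable_epanechnikov [measurable]: "epanechnikov \<epsilon> \<in> borel_measurable borel"
  by (intro borel_measurable_continuous_onI continuous_on_epanechnikov)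

lemma integrable_epanechnikov: "0 \<le> \<epsilon> \<Longrightarrow> integrable lborel (epanechnikov \<epsilon> :: 'a::euclidean_space \<Rightarrow> real)"
proof -
  assume e: "0 \<le> \<epsilon>"
  have "epanechnikov \<epsilon> = (\<lambda>z::'a. indicator (cball 0 \<epsilon>) z *\<^sub>R epanechnikov \<epsilon> z)"
  proof
    show "epanechnikov \<epsilon> z = indicator (cball 0 \<epsilon>) z *\<^sub>R epanechnikov \<epsilon> z" for z :: 'a
      using epanechnikov_eq_0[OF e, of z] by (cases "norm z \<le> \<epsilon>") auto
  qed
  then show ?thesis
    using borel_integrable_compact[OF compact_cball continuous_on_epanechnikov] by metis
qed

lemma kernel_mass_pos:
  assumes "0 < \<epsilon>"
  shows "0 < kernel_mass TYPE('a::euclidean_space) \<epsilon>"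
proof -
  define r where "r = \<epsilon>\<^sup>2 - (\<epsilon> / 2)\<^sup>2"
  have r: "0 < r" using assms by (simp add: r_def power2_eq_square)
  have "0 < r * measure lborel (ball (0::'a) (\<epsilon> / 2))"
    using r assms content_ball_pos[of "\<epsilon> / 2" "0::'a"] by simp
  also have "\<dots> = (\<integral>z. r * indicator (ball (0::'a) (\<epsilon> / 2)) z \<partial>lborel)"
    by simp
  also have "\<dots> \<le> kernel_mass TYPE('a) \<epsilon>"
    unfolding kernel_mass_def
  proof (rule integral_mono)
    show "integrable lborel (\<lambda>z. r * indicator (ball (0::'a) (\<epsilon> / 2)) z)"
      using emeasure_lborel_ball_finite[of "0::'a" "\<epsilon> / 2"]
      by (intro integrable_mult_right integrable_real_indicator) auto
    show "integrable lborel (epanechnikov \<epsilon> :: 'a \<Rightarrow> real)" using assms by (simp add: integrable_epanechnikov)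
    show "r * indicator (ball 0 (\<epsilon> / 2)) z \<le> epanechnikov \<epsilon> z" for z :: 'a
    proof (cases "norm z < \<epsilon> / 2")
      case True
      then have "(norm z)\<^sup>2 \<le> (\<epsilon> / 2)\<^sup>2" by (intro power_mono) auto
      then show ?thesis using True by (simp add: r_def epanechnikov_def)
    qed (simp add: epanechnikov_nonneg)
  qed
  finally show ?thesis .
qed

lemma prob_space_kernel_prob:
  assumes "0 < \<epsilon>"
  shows "prob_space (kernel_prob \<epsilon> :: 'a::euclidean_space measure)"
proof (rule prob_spaceI)
  have "emeasure (kernel_prob \<epsilon> :: 'a measure) (space (kernel_prob \<epsilon>))
      = (\<integral>\<^sup>+z. ennreal (epanechnikov \<epsilon> z / kernel_mass TYPE('a) \<epsilon>) \<partial>(lborel :: 'a measure))"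
    by (simp add: kernel_prob_def emeasure_density)
  also have "\<dots> = ennreal (\<integral>z. epanechnikov \<epsilon> z / kernel_mass TYPE('a) \<epsilon> \<partial>(lborel :: 'a measure))"
    using assms kernel_mass_pos[OF assms, where 'a = 'a]
    by (intro nn_integral_eq_integral) (auto simp: integrable_epanechnikov epanechnikov_nonneg)
  also have "\<dots> = 1"
    using kernel_mass_pos[OF assms, where 'a = 'a] unfolding kernel_mass_def by simp
  finally show "emeasure (kernel_prob \<epsilon> :: 'a measure) (space (kernel_prob \<epsilon>)) = 1" .
qed

lemma sets_kernel_prob [simp]: "sets (kernel_prob \<epsilon>) = sets borel"
  by (simp add: kernel_prob_def)

lemma AE_kernel_prob:
  assumes "0 < \<epsilon>"
  shows "AE z in kernel_prob \<epsilon> :: 'a::euclidean_space measure. norm z \<le> \<epsilon>"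
proof -
  have "AE z::'a in lborel. 0 < ennreal (epanechnikov \<epsilon> z / kernel_mass TYPE('a) \<epsilon>) \<longrightarrow> norm z \<le> \<epsilon>"
  proof (intro AE_I2 impI)
    fix z :: 'a
    assume "0 < ennreal (epanechnikov \<epsilon> z / kernel_mass TYPE('a) \<epsilon>)"
    then show "norm z \<le> \<epsilon>"
      using epanechnikov_eq_0[of \<epsilon> z] assms by (cases "norm z \<le> \<epsilon>") auto
  qed
  then show ?thesis unfolding kernel_prob_def by (subst AE_density) auto
qed

lemma kernel_prob_symmetric:
  "distr (kernel_prob \<epsilon>) borel uminus = (kernel_prob \<epsilon> :: 'a::euclidean_space measure)"
proof -
  have uminus: "distr lborel borel uminus = (lborel :: 'a measure)"
    by (intro lborel_distr_orthogonal_transformation) (auto simp: orthogonal_transformation_def linear_uminus)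
  define k :: "'a \<Rightarrow> ennreal" where "k z = ennreal (epanechnikov \<epsilon> z / kernel_mass TYPE('a) \<epsilon>)" for z
  have [measurable]: "k \<in> borel_measurable borel" unfolding k_def by measurable
  have k: "k (- z) = k z" for z by (simp add: k_def epanechnikov_def)
  have "distr (density lborel (\<lambda>z. k (- z))) borel uminus = density (distr lborel borel uminus) k"
    by (rule density_distr[symmetric]) auto
  moreover have "kernel_prob \<epsilon> = density lborel k" by (simp add: kernel_prob_def k_def[abs_def])
  ultimately show ?thesis by (simp only: uminus k)
qed

definition smoothed_body :: "real \<Rightarrow> 'a::euclidean_space set \<Rightarrow> 'a set" where
  "smoothed_body \<epsilon> K =
     body_of_support (\<lambda>u. \<integral>z. support_function K (u + norm u *\<^sub>R z) \<partial>kernel_prob \<epsilon>)"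

lemma
  fixes K :: "'a::euclidean_space set"
  assumes K: "K \<in> convex_bodies" and e: "0 < \<epsilon>"
  shows smoothed_body_in_convex_bodies: "smoothed_body \<epsilon> K \<in> convex_bodies"
    and support_function_smoothed_body:
      "support_function (smoothed_body \<epsilon> K) u
         = (\<integral>z. support_function K (u + norm u *\<^sub>R z) \<partial>kernel_prob \<epsilon>)"
proof -
  have *: "sublinear (\<lambda>u. \<integral>z. support_function K (u + norm u *\<^sub>R z) \<partial>kernel_prob \<epsilon>)"
    by (rule sublinear_smoothing[OF prob_space_kernel_prob[OF e] sets_kernel_prob
          AE_kernel_prob[OF e] kernel_prob_symmetric sublinear_support_function[OF K]])
  show "smoothed_body \<epsilon> K \<in> convex_bodies"
    unfolding smoothed_body_def by (rule body_of_support_in_convex_bodies[OF *])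
  show "support_function (smoothed_body \<epsilon> K) u
         = (\<integral>z. support_function K (u + norm u *\<^sub>R z) \<partial>kernel_prob \<epsilon>)"
    unfolding smoothed_body_def by (rule support_function_body_of_support[OF *])
qed

lemma (in continuous_additive_map) tendsto_smoothed_body:
  assumes K: "K \<in> convex_bodies" and e: "\<And>i. 0 < e i" "e \<longlonglongrightarrow> 0"
  shows "(\<lambda>i. f (smoothed_body (e i) K)) \<longlonglongrightarrow> f K"
proof -
  note sub = sublinear_support_function[OF K]
  obtain C where C: "0 \<le> C" "\<And>u v. \<bar>support_function K u - support_function K v\<bar> \<le> C * norm (u - v)"
    using sublinear_lipschitz[OF sub] by blast
  show ?thesis
  proof (rule tendsto_of_support_function)
    show "\<bar>support_function (smoothed_body (e i) K) u - support_function K u\<bar> \<le> C * e i"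
      if "norm u = 1" for i u
      using smoothing_close[OF prob_space_kernel_prob[OF e(1)[of i]] sets_kernel_prob
          AE_kernel_prob[OF e(1)[of i]] continuous_on_sublinear[OF sub] C, of u] that
      by (simp add: support_function_smoothed_body K e)
    show "(\<lambda>i. C * e i) \<longlonglongrightarrow> 0" using e(2) by (rule tendsto_mult_right_zero)
  qed (auto intro: K smoothed_body_in_convex_bodies e)
qed

section \<open>Smoothed bodies as integrals of cap bodies\<close>

text \<open>The convex hull of the point \<open>2 w\<close> and the centred ball of radius \<open>1 + |w|\<^sup>2 - \<epsilon>\<^sup>2\<close>.  The radius is
  chosen such that lemma \<open>epanechnikov_eq_support_function_cap_body\<close> holds.\<close>

definition cap_body :: "real \<Rightarrow> 'a::euclidean_space \<Rightarrow> 'a set" where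
  "cap_body \<epsilon> w = body_of_support (\<lambda>u. max ((2 *\<^sub>R w) \<bullet> u) ((1 + (norm w)\<^sup>2 - \<epsilon>\<^sup>2) * norm u))"

lemma
  fixes w :: "'a::euclidean_space"
  assumes e: "0 < \<epsilon>" "\<epsilon> < 1"
  shows cap_body_in_convex_bodies: "cap_body \<epsilon> w \<in> convex_bodies"
    and support_function_cap_body:
      "support_function (cap_body \<epsilon> w) u = max ((2 *\<^sub>R w) \<bullet> u) ((1 + (norm w)\<^sup>2 - \<epsilon>\<^sup>2) * norm u)"
proof -
  have "\<epsilon>\<^sup>2 \<le> 1" using e by (simp add: power_le_one)
  then have c: "0 \<le> 1 + (norm w)\<^sup>2 - \<epsilon>\<^sup>2" using zero_le_power2[of "norm w"] by linarith
  have max_add: "max x y \<le> max p r + max q s" if "x \<le> p + q" "y \<le> r + s" for x y p q r s :: real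
    using that by linarith
  have *: "sublinear (\<lambda>u. max ((2 *\<^sub>R w) \<bullet> u) ((1 + (norm w)\<^sup>2 - \<epsilon>\<^sup>2) * norm u))"
    unfolding sublinear_def
  proof (intro conjI allI impI)
    fix u v :: 'a
    show "max ((2 *\<^sub>R w) \<bullet> (u + v)) ((1 + (norm w)\<^sup>2 - \<epsilon>\<^sup>2) * norm (u + v))
      \<le> max ((2 *\<^sub>R w) \<bullet> u) ((1 + (norm w)\<^sup>2 - \<epsilon>\<^sup>2) * norm u)
        + max ((2 *\<^sub>R w) \<bullet> v) ((1 + (norm w)\<^sup>2 - \<epsilon>\<^sup>2) * norm v)"
      using mult_left_mono[OF norm_triangle_ineq[of u v] c]
      by (intro max_add) (simp_all add: inner_add_right distrib_left)
  next
    fix t u assume "0 \<le> (t::real)"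
    then show "max ((2 *\<^sub>R w) \<bullet> (t *\<^sub>R u)) ((1 + (norm w)\<^sup>2 - \<epsilon>\<^sup>2) * norm (t *\<^sub>R u))
      = t * max ((2 *\<^sub>R w) \<bullet> u) ((1 + (norm w)\<^sup>2 - \<epsilon>\<^sup>2) * norm u)"
      by (simp add: max_mult_distrib_left mult.left_commute)
  qed
  show "cap_body \<epsilon> w \<in> convex_bodies"
    unfolding cap_body_def by (rule body_of_support_in_convex_bodies[OF *])
  show "support_function (cap_body \<epsilon> w) u = max ((2 *\<^sub>R w) \<bullet> u) ((1 + (norm w)\<^sup>2 - \<epsilon>\<^sup>2) * norm u)"
    unfolding cap_body_def by (rule support_function_body_of_support[OF *])
qed

lemma epanechnikov_eq_support_function_cap_body:
  assumes e: "0 < \<epsilon>" "\<epsilon> < 1" and u: "norm u = 1"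
  shows "epanechnikov \<epsilon> (w - u) = support_function (cap_body \<epsilon> w) u - (1 + (norm w)\<^sup>2 - \<epsilon>\<^sup>2)"
proof -
  have "(norm (w - u))\<^sup>2 = (norm w)\<^sup>2 + 1 - 2 * (w \<bullet> u)"
    using u dot_norm_neg[of w u] by (simp add: field_simps)
  then show ?thesis
    by (simp add: epanechnikov_def support_function_cap_body[OF e] u max_def)
qed

lemma cap_body_lipschitz:
  fixes w w' :: "'a::euclidean_space"
  assumes e: "0 < \<epsilon>" "\<epsilon> < 1" and u: "norm u = 1" and w: "w \<in> cball 0 R" "w' \<in> cball 0 R"
  shows "\<bar>support_function (cap_body \<epsilon> w) u - support_function (cap_body \<epsilon> w') u\<bar> \<le> (2 + 2 * R) * dist w w'"
proof -
  have "\<bar>(2 *\<^sub>R w) \<bullet> u - (2 *\<^sub>R w') \<bullet> u\<bar> = 2 * \<bar>(w - w') \<bullet> u\<bar>"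
  proof -
    have "(2 *\<^sub>R w) \<bullet> u - (2 *\<^sub>R w') \<bullet> u = 2 * ((w - w') \<bullet> u)"
      by (simp add: inner_diff_left)
    then show ?thesis by (simp only: abs_mult)
  qed
  also have "\<dots> \<le> 2 * dist w w'"
    using Cauchy_Schwarz_ineq2[of "w - w'" u] u by (simp add: dist_norm)
  finally have 1: "\<bar>(2 *\<^sub>R w) \<bullet> u - (2 *\<^sub>R w') \<bullet> u\<bar> \<le> 2 * dist w w'" .
  have "\<bar>(norm w)\<^sup>2 - (norm w')\<^sup>2\<bar> = (norm w + norm w') * \<bar>norm w - norm w'\<bar>"
    by (simp add: power2_eq_square square_diff_square_factored abs_mult)
  also have "\<dots> \<le> (2 * R) * dist w w'"
    using w by (intro mult_mono) (auto simp: dist_norm norm_triangle_ineq3 intro: order_trans[OF norm_ge_zero])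
  finally have 2: "\<bar>(norm w)\<^sup>2 - (norm w')\<^sup>2\<bar> \<le> (2 * R) * dist w w'" .
  show ?thesis
    using 1 2 unfolding support_function_cap_body[OF e] distrib_right u mult_1_right by linarith
qed

lemma support_function_nonneg:
  fixes K :: "'a::euclidean_space set"
  assumes "K \<in> convex_bodies" "0 \<in> K"
  shows "0 \<le> support_function K u"
  using inner_le_support_function[OF assms, of u] by simp

text \<open>The translation \<open>w = u + z\<close> writes the support function of the smoothed body at a unit vector \<open>u\<close>
  as the integral of the support functions of cap bodies against the measure \<open>M\<close> with density
  \<open>h\<^sub>K / Z\<close>, minus a constant \<open>r\<close>.  The constant is accounted for by adding a ball of radius \<open>r\<close>.
  The hypothesis \<open>0 \<in> K\<close> makes the density nonnegative, and the radius \<open>2\<close> suffices since the kernel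
  vanishes at \<open>w - u\<close> for \<open>|w| > 2\<close>.\<close>

lemma (in continuous_additive_map) map_smoothed_body:
  assumes ball: "\<And>r. 0 \<le> r \<Longrightarrow> f (cball 0 r) = 0"
    and K: "K \<in> convex_bodies" "0 \<in> K" and e: "0 < \<epsilon>" "\<epsilon> < 1"
  shows "f (smoothed_body \<epsilon> K) =
    (\<integral>w. indicator (cball 0 2) w *\<^sub>R (support_function K w / kernel_mass TYPE('a) \<epsilon>) *\<^sub>R f (cap_body \<epsilon> w) \<partial>lborel)"
proof -
  define Z where "Z = kernel_mass TYPE('a) \<epsilon>"
  have Z: "0 < Z" using kernel_mass_pos[OF e(1)] by (simp add: Z_def)
  define h where "h = support_function K"
  have h: "continuous_on S h" for S
    unfolding h_def by (intro continuous_on_sublinear sublinear_support_function K)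
  have h0: "0 \<le> h w" for w unfolding h_def by (rule support_function_nonneg[OF K])
  have [measurable]: "h \<in> borel_measurable borel" by (intro borel_measurable_continuous_onI h)
  define S :: "'a set" where "S = cball 0 2"
  have S: "S \<in> sets borel" "compact S" by (auto simp: S_def)
  define c where "c w = 1 + (norm w)\<^sup>2 - \<epsilon>\<^sup>2" for w :: 'a
  have "\<epsilon>\<^sup>2 \<le> 1" using e by (simp add: power_le_one)
  then have c0: "0 \<le> c w" for w using zero_le_power2[of "norm w"] unfolding c_def by linarith
  define b where "b w u = support_function (cap_body \<epsilon> w) u" for w u :: 'a
  have b: "b w u = max ((2 *\<^sub>R w) \<bullet> u) (c w * norm u)" for w u
    by (simp add: b_def c_def support_function_cap_body[OF e])
  have cont_b: "continuous_on A (\<lambda>w. b w u)" for A u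
    unfolding b c_def by (intro continuous_intros)
  have cont_f: "continuous_on S (\<lambda>w. f (cap_body \<epsilon> w))"
    unfolding S_def
    by (rule continuous_on_comp_body_family[OF cap_body_in_convex_bodies[OF e] cap_body_lipschitz[OF e]])
  define N where "N = restrict_space lborel S"
  define M where "M = density N (\<lambda>w. ennreal (h w / Z))"
  have sets_N: "sets N = sets (restrict_space borel S)"
    by (simp add: N_def sets_restrict_space)
  have meas_N: "g \<in> borel_measurable N" if "continuous_on S g" for g :: "'a \<Rightarrow> 'd::topological_space"
    using borel_measurable_continuous_on_restrict[OF that] measurable_cong_sets[OF sets_N refl] by blast
  have int_N: "integrable N g" if "continuous_on S g" for g :: "'a \<Rightarrow> real"
    unfolding N_def using borel_integrable_compact[OF S(2) that] S(1)
    by (subst integrable_restrict_space) (auto simp: mult.commute)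
  have h_N: "(\<lambda>w. h w / Z) \<in> borel_measurable N" "integrable N (\<lambda>w. h w / Z)"
    by (intro meas_N int_N continuous_intros h, use Z in simp)+
  have int_M: "(\<integral>w. g w \<partial>M) = (\<integral>w. indicator S w *\<^sub>R (h w / Z) *\<^sub>R g w \<partial>lborel)"
    if "continuous_on S g" for g :: "'a \<Rightarrow> 'd::euclidean_space"
    unfolding M_def using meas_N[OF that] h_N h0 Z S(1)
    by (subst integral_density) (auto simp: N_def integral_restrict_space)
  have fin_M: "finite_measure M"
  proof (rule finite_measureI)
    have "emeasure M (space M) = (\<integral>\<^sup>+w. ennreal (h w / Z) \<partial>N)"
      unfolding M_def using h_N(1) by (simp add: emeasure_density cong: nn_integral_cong)
    also have "\<dots> = ennreal (\<integral>w. h w / Z \<partial>N)"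
      using h_N h0 Z by (intro nn_integral_eq_integral) auto
    finally show "emeasure M (space M) \<noteq> \<infinity>" by simp
  qed
  define r where "r = (\<integral>w. c w \<partial>M)"
  have cont_c: "continuous_on A c" for A unfolding c_def by (intro continuous_intros)
  have r0: "0 \<le> r" unfolding r_def using c0 by simp
  note T = smoothed_body_in_convex_bodies[OF K(1) e(1)]
  have "f (smoothed_body \<epsilon> K + cball 0 r) = (\<integral>w. f (cap_body \<epsilon> w) \<partial>M)"
  proof (rule map_integral[OF fin_M])
    show "sets M = sets (restrict_space borel (cball 0 2))" by (simp add: M_def sets_N S_def)
    show "smoothed_body \<epsilon> K + cball 0 r \<in> convex_bodies" by (intro convex_bodies_plus T) (simp add: r0)
    fix u :: 'a assume u: "norm u = 1"
    define g where "g w = epanechnikov \<epsilon> (w - u) / Z * h w" for w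
    have "support_function (smoothed_body \<epsilon> K) u = (\<integral>z. h (u + z) \<partial>kernel_prob \<epsilon>)"
      by (simp add: support_function_smoothed_body K e u h_def)
    also have "\<dots> = (\<integral>z. g (u + z) \<partial>lborel)"
      unfolding kernel_prob_def using Z
      by (subst integral_density) (auto simp: g_def Z_def epanechnikov_nonneg)
    also have "\<dots> = (\<integral>w. g w \<partial>lborel)"
      by (rule integral_lborel_translate) (simp add: g_def)
    also have "\<dots> = (\<integral>w. indicator S w *\<^sub>R (h w / Z) *\<^sub>R (b w u - c w) \<partial>lborel)"
    proof (intro Bochner_Integration.integral_cong refl)
      fix w :: 'a
      show "g w = indicator S w *\<^sub>R (h w / Z) *\<^sub>R (b w u - c w)"
      proof (cases "w \<in> S")
        case True
        then show ?thesis
          by (simp add: g_def b_def c_def epanechnikov_eq_support_function_cap_body[OF e u] mult.commute)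
      next
        case False
        then have "\<epsilon> \<le> norm (w - u)"
          using norm_triangle_ineq2[of w u] u e by (simp add: S_def)
        then show ?thesis using False e by (simp add: g_def epanechnikov_eq_0)
      qed
    qed
    also have "\<dots> = (\<integral>w. b w u - c w \<partial>M)"
      by (rule int_M[symmetric]) (intro continuous_intros cont_b cont_c)
    also have "\<dots> = (\<integral>w. b w u \<partial>M) - r"
      unfolding r_def
    proof (rule Bochner_Integration.integral_diff)
      show "integrable M (\<lambda>w. b w u)" "integrable M c"
        unfolding M_def using h_N(1) h0 Z
        by (subst integrable_density; auto intro!: meas_N cont_b cont_c int_N continuous_intros h)+
    qed
    finally show "support_function (smoothed_body \<epsilon> K + cball 0 r) u
        = (\<integral>w. support_function (cap_body \<epsilon> w) u \<partial>M)"
      by (simp add: support_function_plus T r0 support_function_cball u b_def)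
  qed (use cap_body_in_convex_bodies[OF e] cap_body_lipschitz[OF e] in auto)
  then show ?thesis
    using additive[OF T, of "cball 0 r"] r0 ball int_M[OF cont_f] by (simp add: S_def h_def Z_def)
qed

section \<open>Integration in polar coordinates\<close>

lemma borel_measurable_comp_sgn:
  fixes G :: "'a::euclidean_space \<Rightarrow> 'b::{banach, second_countable_topology}"
  assumes G: "continuous_on (sphere 0 1) G"
  shows "(\<lambda>w. G (sgn w)) \<in> borel_measurable borel"
proof (rule borel_measurable_continuous_countable_exceptions[of "{0}"])
  show "continuous_on (- {0}) (\<lambda>w. G (sgn w))"
    by (intro continuous_on_compose2[OF G] continuous_on_sgn continuous_intros) (auto simp: norm_sgn split: if_splits)
qed simp

text \<open>Normalise the radial density to a probability measure \<open>D\<close>.  Its image under the radial projection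
  is a rotation-invariant probability measure on the sphere and hence is the sphere measure.  The
  lower bound on \<open>\<rho>\<close> serves to make the total mass positive.\<close>

lemma integral_radial_ge_one:
  fixes G :: "'a::euclidean_space \<Rightarrow> 'b::{banach, second_countable_topology}"
  assumes R: "0 < R" and \<rho>: "continuous_on {0..R} \<rho>" "\<And>r. r \<in> {0..R} \<Longrightarrow> 1 \<le> \<rho> r"
    and G: "continuous_on (sphere 0 1) G"
  shows "(\<integral>w. indicator (cball 0 R) w *\<^sub>R \<rho> (norm w) *\<^sub>R G (sgn w) \<partial>lborel)
       = (\<integral>w. indicator (cball (0::'a) R) w *\<^sub>R \<rho> (norm w) \<partial>lborel) *\<^sub>R (\<integral>u. G u \<partial>sphere_measure)"
proof -
  define k where "k w = indicator (cball (0::'a) R) w *\<^sub>R \<rho> (norm w)" for w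
  define m where "m = (\<integral>w. k w \<partial>lborel)"
  have cont: "continuous_on (cball (0::'a) R) (\<lambda>w. \<rho> (norm w))"
    by (intro continuous_on_compose2[OF \<rho>(1)] continuous_intros) auto
  have int_k: "integrable lborel k"
    unfolding k_def using borel_integrable_compact[OF compact_cball cont] by simp
  have k_meas[measurable]: "k \<in> borel_measurable borel"
    using int_k by (auto dest: borel_measurable_integrable)
  have k0: "0 \<le> k w" for w
    using \<rho>(2)[of "norm w"] by (auto simp: k_def indicator_def)
  have "0 < measure lborel (cball (0::'a) R)" using content_cball_pos[OF R] by simp
  also have "\<dots> = (\<integral>w. indicator (cball (0::'a) R) w \<partial>lborel)" by simp
  also have "\<dots> \<le> m"
    unfolding m_def
  proof (rule integral_mono)
    show "integrable lborel (indicator (cball (0::'a) R) :: 'a \<Rightarrow> real)"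
      by (intro integrable_real_indicator) (use emeasure_lborel_cball_finite[of "0::'a" R] in \<open>auto simp: less_top\<close>)
    show "indicator (cball 0 R) w \<le> k w" for w
      using \<rho>(2)[of "norm w"] by (auto simp: k_def indicator_def)
  qed (rule int_k)
  finally have m: "0 < m" .
  define D :: "'a measure" where "D = density lborel (\<lambda>w. ennreal (k w / m))"
  have [measurable_cong, simp]: "sets D = sets borel" by (simp add: D_def)
  have prob_D: "prob_space D"
  proof (rule prob_spaceI)
    have "emeasure D (space D) = (\<integral>\<^sup>+w. ennreal (k w / m) \<partial>lborel)"
      by (simp add: D_def emeasure_density)
    also have "\<dots> = ennreal (\<integral>w. k w / m \<partial>lborel)"
      using int_k k0 m by (intro nn_integral_eq_integral) auto
    finally show "emeasure D (space D) = 1" using m by (simp flip: m_def)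
  qed
  define S :: "'a measure" where "S = restrict_space borel (sphere 0 1)"
  \<comment> \<open>The radial projection, with an arbitrary unit vector as value at the origin, a null set.\<close>
  define p :: "'a \<Rightarrow> 'a" where "p = (\<lambda>x. if x = 0 then SOME b. b \<in> Basis else sgn x)"
  have pS: "p x \<in> sphere 0 1" for x
    by (auto simp: p_def norm_sgn some_in_eq)
  have p_borel: "p \<in> borel_measurable borel" unfolding p_def sgn_div_norm by measurable
  then have pm[measurable]: "p \<in> measurable D S"
    unfolding S_def by (intro measurable_restrict_space2) (use pS in auto)
  have pmb: "p \<in> measurable borel S"
    unfolding S_def by (intro measurable_restrict_space2) (use pS p_borel in auto)
  have AE_D: "AE x in D. x \<noteq> 0"
  proof -
    have "AE x::'a in lborel. x \<noteq> 0" by (rule AE_lborel_singleton)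
    then show ?thesis unfolding D_def by (subst AE_density) auto
  qed
  define N where "N = distr D S p"
  have "distr N N T = N" if T: "orthogonal_transformation T" for T
  proof -
    note Tb = borel_measurable_orthogonal_transformation[OF T]
    have TS: "T \<in> measurable S S"
      using Tb T unfolding S_def
      by (intro measurable_restrict_space3) (auto simp: orthogonal_transformation_norm)
    have TN: "T \<in> measurable N S" using TS by (simp add: N_def)
    have kT: "k (T w) = k w" for w by (simp add: k_def orthogonal_transformation_norm[OF T] indicator_def)
    have "distr (density lborel (\<lambda>w. ennreal (k (T w) / m))) borel T
        = density (distr lborel borel T) (\<lambda>w. ennreal (k w / m))"
      by (rule density_distr[symmetric]) (use Tb in auto)
    then have DT: "distr D borel T = D"
      by (simp add: D_def lborel_distr_orthogonal_transformation[OF T] kT)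
    have "distr N N T = distr N S T" by (rule distr_cong) (simp_all add: N_def)
    also have "\<dots> = distr D S (T \<circ> p)" unfolding N_def by (rule distr_distr) (use TS pm in auto)
    also have "\<dots> = distr D S (p \<circ> T)"
    proof (rule distr_cong_AE)
      show "AE x in D. (T \<circ> p) x = (p \<circ> T) x"
        using AE_D
      proof eventually_elim
        case (elim x)
        then have "T x \<noteq> 0" using orthogonal_transformation_norm[OF T, of x] by (metis norm_eq_zero)
        with elim show ?case
          using T by (simp add: p_def sgn_div_norm orthogonal_transformation_norm
              orthogonal_transformation_linear linear_scale)
      qed
      show "T \<circ> p \<in> measurable D S" using pm TS by (rule measurable_comp)
      show "p \<circ> T \<in> measurable D S"
        using Tb pmb by (intro measurable_comp[of T D borel]) auto
    qed simp_all
    also have "\<dots> = distr (distr D borel T) S p" using Tb pmb by (intro distr_distr[symmetric]) auto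
    also have "\<dots> = N" by (simp add: DT N_def)
    finally show ?thesis .
  qed
  then have "rotation_invariant_prob N"
    unfolding rotation_invariant_prob_def
    using prob_space.prob_space_distr[OF prob_D pm] by (simp add: N_def S_def)
  then have N: "N = sphere_measure"
    by (rule rotation_invariant_prob_unique[OF _ rotation_invariant_prob_sphere_measure])
  have GS: "G \<in> borel_measurable S"
    unfolding S_def using G by (rule borel_measurable_continuous_on_restrict)
  have "(\<integral>u. G u \<partial>sphere_measure) = (\<integral>w. G (p w) \<partial>D)"
    unfolding N[symmetric] N_def by (rule integral_distr[OF pm GS])
  also have "\<dots> = (\<integral>w. (k w / m) *\<^sub>R G (p w) \<partial>lborel)"
    unfolding D_def
  proof (rule integral_density)
    show "(\<lambda>w. G (p w)) \<in> borel_measurable lborel"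
      using measurable_compose[OF pmb GS] by simp
  qed (use k0 m in auto)
  also have "\<dots> = (\<integral>w. (1 / m) *\<^sub>R (k w *\<^sub>R G (p w)) \<partial>lborel)"
    by (simp add: divide_inverse mult.commute)
  also have "\<dots> = (1 / m) *\<^sub>R (\<integral>w. k w *\<^sub>R G (p w) \<partial>lborel)"
    by (rule integral_scaleR_right) 
  finally have "m *\<^sub>R (\<integral>u. G u \<partial>sphere_measure) = (\<integral>w. k w *\<^sub>R G (p w) \<partial>lborel)"
    using m by simp
  also have "\<dots> = (\<integral>w. k w *\<^sub>R G (sgn w) \<partial>lborel)"
  proof (rule integral_cong_AE)
    show "(\<lambda>w. k w *\<^sub>R G (p w)) \<in> borel_measurable lborel"
      using measurable_compose[OF pmb GS] by simp
    show "(\<lambda>w. k w *\<^sub>R G (sgn w)) \<in> borel_measurable lborel"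
      using borel_measurable_comp_sgn[OF G] by simp
    show "AE w in lborel. k w *\<^sub>R G (p w) = k w *\<^sub>R G (sgn w)"
      using AE_lborel_singleton[of 0] by eventually_elim (simp add: p_def)
  qed
  finally show ?thesis by (simp add: k_def m_def)
qed

lemma integrable_radial:
  fixes G :: "'a::euclidean_space \<Rightarrow> 'b::{banach, second_countable_topology}"
  assumes \<rho>: "continuous_on {0..R} \<rho>" and G: "continuous_on (sphere 0 1) G"
  shows "integrable lborel (\<lambda>w. indicator (cball 0 R) w *\<^sub>R \<rho> (norm w) *\<^sub>R G (sgn w))"
proof -
  have cont: "continuous_on (cball (0::'a) R) (\<lambda>w. \<rho> (norm w))"
    by (intro continuous_on_compose2[OF \<rho>] continuous_intros) auto
  have int: "integrable lborel (\<lambda>w::'a. indicator (cball 0 R) w *\<^sub>R \<rho> (norm w))"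
    using borel_integrable_compact[OF compact_cball cont] by simp
  obtain b where b: "\<And>u. u \<in> sphere 0 1 \<Longrightarrow> norm (G u) \<le> b"
    using compact_imp_bounded[OF compact_continuous_image[OF G compact_sphere]]
    unfolding bounded_iff by blast
  have "integrable lborel (\<lambda>w. (indicator (cball 0 R) w *\<^sub>R \<rho> (norm w)) *\<^sub>R G (sgn w))"
  proof (rule Bochner_Integration.integrable_bound)
    show "integrable lborel (\<lambda>w::'a. b * (indicator (cball 0 R) w *\<^sub>R \<rho> (norm w)))"
      using int by (rule integrable_mult_right)
    show "(\<lambda>w. (indicator (cball 0 R) w *\<^sub>R \<rho> (norm w)) *\<^sub>R G (sgn w)) \<in> borel_measurable lborel"
      using borel_measurable_integrable[OF int] borel_measurable_comp_sgn[OF G] by simp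
    show "AE w in lborel. norm ((indicator (cball 0 R) w *\<^sub>R \<rho> (norm w)) *\<^sub>R G (sgn w))
        \<le> norm (b * (indicator (cball (0::'a) R) w *\<^sub>R \<rho> (norm w)))"
      using AE_lborel_singleton[of "0::'a"]
    proof eventually_elim
      case (elim w)
      then have "norm (G (sgn w)) \<le> \<bar>b\<bar>" using b[of "sgn w"] by (simp add: norm_sgn)
      then show ?case by (simp add: abs_mult mult.commute mult_right_mono)
    qed
  qed
  then show ?thesis by simp
qed

text \<open>Both sides are linear in \<open>\<rho>\<close>, and \<open>\<rho>\<close> is a difference of two functions that are at least one.\<close>

lemma integral_radial:
  fixes G :: "'a::euclidean_space \<Rightarrow> 'b::{banach, second_countable_topology}"
  assumes R: "0 < R" and \<rho>: "continuous_on {0..R} \<rho>" and G: "continuous_on (sphere 0 1) G"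
  shows "(\<integral>w. indicator (cball 0 R) w *\<^sub>R \<rho> (norm w) *\<^sub>R G (sgn w) \<partial>lborel)
       = (\<integral>w. indicator (cball (0::'a) R) w *\<^sub>R \<rho> (norm w) \<partial>lborel) *\<^sub>R (\<integral>u. G u \<partial>sphere_measure)"
proof -
  obtain b where b: "\<And>r. r \<in> {0..R} \<Longrightarrow> \<bar>\<rho> r\<bar> \<le> b"
    using compact_imp_bounded[OF compact_continuous_image[OF \<rho> compact_Icc]]
    unfolding bounded_iff real_norm_def by blast
  define c where "c = \<bar>b\<bar> + 1"
  have \<rho>c: "continuous_on {0..R} (\<lambda>r. \<rho> r + c)" by (intro continuous_intros \<rho>)
  have pos: "1 \<le> \<rho> r + c" if "r \<in> {0..R}" for r using b[OF that] by (simp add: c_def)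
  have c: "continuous_on {0..R} (\<lambda>r. c)" "1 \<le> c" by (simp_all add: c_def)
  have diff: "(\<integral>w. indicator (cball (0::'a) R) w *\<^sub>R \<rho> (norm w) *\<^sub>R H (sgn w) \<partial>lborel)
      = (\<integral>w. indicator (cball 0 R) w *\<^sub>R (\<rho> (norm w) + c) *\<^sub>R H (sgn w) \<partial>lborel)
        - (\<integral>w. indicator (cball 0 R) w *\<^sub>R c *\<^sub>R H (sgn w) \<partial>lborel)"
    if "continuous_on (sphere 0 1) H" for H :: "'a \<Rightarrow> 'c::{banach, second_countable_topology}"
    using Bochner_Integration.integral_diff[OF integrable_radial[OF \<rho>c that] integrable_radial[OF c(1) that]]
    by (simp add: algebra_simps)
  show ?thesis
    using diff[OF G] diff[of "\<lambda>_. 1::real"] integral_radial_ge_one[OF R \<rho>c pos G]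
      integral_radial_ge_one[OF R c(1) c(2) G]
    by (simp add: scaleR_left_diff_distrib)
qed


section \<open>Moments of the sphere measure and the Steiner point\<close>

lemma prob_space_sphere_measure: "prob_space (sphere_measure :: 'a::euclidean_space measure)"
  and sets_sphere_measure:
    "sets (sphere_measure :: 'a measure) = sets (restrict_space borel (sphere 0 1))"
  and space_sphere_measure: "space (sphere_measure :: 'a measure) = sphere 0 1"
proof -
  show "prob_space (sphere_measure :: 'a measure)"
    and 1: "sets (sphere_measure :: 'a measure) = sets (restrict_space borel (sphere 0 1))"
    using rotation_invariant_prob_sphere_measure unfolding rotation_invariant_prob_def by blast+
  show "space (sphere_measure :: 'a measure) = sphere 0 1"
    using sets_eq_imp_space_eq[OF 1] by (simp add: space_restrict_space)
qed

lemma borel_measurable_sphere_measure: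
  fixes G :: "'a::euclidean_space \<Rightarrow> 'b::topological_space"
  assumes "continuous_on (sphere 0 1) G"
  shows "G \<in> borel_measurable sphere_measure"
  using borel_measurable_continuous_on_restrict[OF assms] measurable_cong_sets[OF sets_sphere_measure refl]
  by blast

lemma integrable_sphere_measure:
  fixes G :: "'a::euclidean_space \<Rightarrow> 'b::{banach, second_countable_topology}"
  assumes G: "continuous_on (sphere 0 1) G"
  shows "integrable sphere_measure G"
proof -
  interpret prob_space "sphere_measure :: 'a measure" by (rule prob_space_sphere_measure)
  obtain b where "\<And>u. u \<in> sphere 0 1 \<Longrightarrow> norm (G u) \<le> b"
    using compact_imp_bounded[OF compact_continuous_image[OF G compact_sphere]]
    unfolding bounded_iff by blast
  then show ?thesis
    by (intro integrable_const_bound[where B = b] AE_I2 borel_measurable_sphere_measure G)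
       (simp add: space_sphere_measure)
qed

lemma integral_sphere_measure_orthogonal:
  fixes G :: "'a::euclidean_space \<Rightarrow> 'b::{banach, second_countable_topology}" and T :: "'a \<Rightarrow> 'a"
  assumes T: "orthogonal_transformation T" and G: "continuous_on (sphere 0 1) G"
  shows "(\<integral>u. G (T u) \<partial>sphere_measure) = (\<integral>u. G u \<partial>sphere_measure)"
proof -
  have inv: "distr sphere_measure sphere_measure T = (sphere_measure :: 'a measure)"
    using rotation_invariant_prob_sphere_measure T unfolding rotation_invariant_prob_def by blast
  have "T \<in> measurable (restrict_space borel (sphere 0 1)) (restrict_space borel (sphere 0 1))"
    using borel_measurable_orthogonal_transformation[OF T] T
    by (intro measurable_restrict_space3) (auto simp: orthogonal_transformation_norm)
  then have Tm: "T \<in> measurable sphere_measure sphere_measure"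
    using measurable_cong_sets[OF sets_sphere_measure sets_sphere_measure] by blast
  show ?thesis
    using integral_distr[OF Tm borel_measurable_sphere_measure[OF G]] by (simp add: inv)
qed

lemma integral_sphere_measure_self: "(\<integral>u. u \<partial>sphere_measure) = (0 :: 'a::euclidean_space)"
proof -
  have "orthogonal_transformation (uminus :: 'a \<Rightarrow> 'a)"
    by (auto simp: orthogonal_transformation_def linear_uminus)
  from integral_sphere_measure_orthogonal[OF this, of "\<lambda>u. u"]
  have "- (\<integral>u. u \<partial>sphere_measure) = (\<integral>u. (u::'a) \<partial>sphere_measure)"
    by (simp add: continuous_on_id)
  then have "(2::real) *\<^sub>R (\<integral>u. (u::'a) \<partial>sphere_measure) = 0"
    unfolding scaleR_2 by (metis add.left_inverse)
  then show ?thesis by simp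
qed

text \<open>The symmetric bilinear form on the left is invariant under rotations, hence its quadratic form is
  constant on the unit sphere and the form is a multiple of the inner product; its trace is one
  because \<open>|u| = 1\<close> on the sphere.\<close>

lemma sphere_measure_second_moment:
  fixes x y :: "'a::euclidean_space"
  shows "(\<integral>u. (u \<bullet> x) * (u \<bullet> y) \<partial>sphere_measure) = (x \<bullet> y) / real DIM('a)"
proof -
  interpret prob_space "sphere_measure :: 'a measure" by (rule prob_space_sphere_measure)
  define q where "q x y = (\<integral>u. (u \<bullet> x) * (u \<bullet> y) \<partial>sphere_measure)" for x y :: 'a
  have int: "integrable sphere_measure (\<lambda>u. (u \<bullet> x) * (u \<bullet> y))" for x y :: 'a
    by (intro integrable_sphere_measure continuous_intros)
  have q_eq: "q x x = q y y" if xy: "norm x = norm y" for x y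
  proof -
    obtain T where T: "orthogonal_transformation T" "T x = y"
      using orthogonal_transformation_transitive[OF xy] by blast
    have "q y y = (\<integral>u. (T u \<bullet> y) * (T u \<bullet> y) \<partial>sphere_measure)"
      unfolding q_def
      by (rule integral_sphere_measure_orthogonal[OF T(1), symmetric]) (intro continuous_intros)
    also have "\<dots> = q x x"
      using T by (simp add: q_def orthogonal_transformation_def flip: T(2))
    finally show ?thesis ..
  qed
  obtain e :: 'a where e: "norm e = 1" using norm_Basis nonempty_Basis by blast
  have q_sq: "q x x = (x \<bullet> x) * q e e" for x
  proof -
    have "q x x = q (norm x *\<^sub>R e) (norm x *\<^sub>R e)" by (rule q_eq) (simp add: e)
    also have "\<dots> = (x \<bullet> x) * q e e"
      by (simp add: q_def dot_square_norm power2_eq_square mult.assoc mult.left_commute)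
    finally show ?thesis .
  qed
  have "(\<Sum>b\<in>Basis. q b b) = (\<integral>u. (\<Sum>b\<in>Basis. (u \<bullet> b) * (u \<bullet> b)) \<partial>(sphere_measure :: 'a measure))"
    unfolding q_def by (rule Bochner_Integration.integral_sum[symmetric]) (rule int)
  also have "\<dots> = (\<integral>u. 1 \<partial>(sphere_measure :: 'a measure))"
  proof (rule Bochner_Integration.integral_cong[OF refl])
    fix u :: 'a assume "u \<in> space sphere_measure"
    then have "u \<bullet> u = 1" by (simp add: space_sphere_measure dot_square_norm)
    then show "(\<Sum>b\<in>Basis. (u \<bullet> b) * (u \<bullet> b)) = 1" by (simp flip: euclidean_inner)
  qed
  finally have "(\<Sum>b\<in>Basis. q b b) = 1" by (simp add: prob_space)
  moreover have "(\<Sum>b\<in>Basis. q b b) = real DIM('a) * q e e"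
  proof -
    have "(\<Sum>b\<in>Basis. q b b) = (\<Sum>b::'a\<in>Basis. q e e)"
      by (intro sum.cong refl q_eq) (simp add: e)
    then show ?thesis by simp
  qed
  ultimately have qe: "q e e = 1 / real DIM('a)" by (simp add: field_simps)
  have "q (x + y) (x + y) = q x x + q y y + 2 * q x y"
  proof -
    have "q (x + y) (x + y) = (\<integral>u. (u \<bullet> x) * (u \<bullet> x) + (u \<bullet> y) * (u \<bullet> y)
        + 2 * ((u \<bullet> x) * (u \<bullet> y)) \<partial>sphere_measure)"
      by (simp add: q_def inner_add_right algebra_simps)
    then show ?thesis by (simp add: q_def int)
  qed
  then have "2 * q x y = (2 * (x \<bullet> y)) * q e e"
    unfolding q_sq[of "x + y"] q_sq[of x] q_sq[of y] by (simp add: inner_add_left inner_add_right inner_commute algebra_simps)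
  then show ?thesis by (simp add: qe flip: q_def)
qed

lemma integral_sphere_measure_inner_scaleR:
  fixes x :: "'a::euclidean_space"
  shows "(\<integral>u. (u \<bullet> x) *\<^sub>R u \<partial>sphere_measure) = x /\<^sub>R real DIM('a)"
proof (rule euclidean_eqI)
  fix b :: 'a assume "b \<in> Basis"
  have "(\<integral>u. (u \<bullet> x) *\<^sub>R u \<partial>sphere_measure) \<bullet> b = (\<integral>u. ((u \<bullet> x) *\<^sub>R u) \<bullet> b \<partial>sphere_measure)"
    by (intro integral_inner_left[symmetric] impI integrable_sphere_measure continuous_intros)
  then show "(\<integral>u. (u \<bullet> x) *\<^sub>R u \<partial>sphere_measure) \<bullet> b = (x /\<^sub>R real DIM('a)) \<bullet> b"
    by (simp add: sphere_measure_second_moment divide_inverse inner_commute mult.commute)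
qed

definition steiner_integral :: "'a::euclidean_space set \<Rightarrow> 'a" where
  "steiner_integral K = (\<integral>u. support_function K u *\<^sub>R u \<partial>sphere_measure)"

lemma steiner_point_eq: "steiner_point K = real DIM('a) *\<^sub>R steiner_integral (K :: 'a::euclidean_space set)"
  by (simp add: steiner_point_def steiner_integral_def)

lemma steiner_integral_plus:
  fixes K L :: "'a::euclidean_space set"
  assumes K: "K \<in> convex_bodies" and L: "L \<in> convex_bodies"
  shows "steiner_integral (K + L) = steiner_integral K + steiner_integral L"
proof -
  have "integrable sphere_measure (\<lambda>u. support_function C u *\<^sub>R u)" if "C \<in> convex_bodies" for C :: "'a set"
    by (intro integrable_sphere_measure continuous_intros continuous_on_sublinear
        sublinear_support_function that)
  then show ?thesis
    unfolding steiner_integral_def using K L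
    by (simp add: support_function_plus scaleR_add_left)
qed

lemma steiner_integral_cball: "0 \<le> r \<Longrightarrow> steiner_integral (cball 0 r) = (0 :: 'a::euclidean_space)"
proof -
  assume r: "0 \<le> r"
  have "steiner_integral (cball 0 r) = (\<integral>u. r *\<^sub>R (u::'a) \<partial>sphere_measure)"
    unfolding steiner_integral_def using r
    by (intro Bochner_Integration.integral_cong)
       (simp_all add: support_function_cball space_sphere_measure)
  then show ?thesis by (simp add: integral_sphere_measure_self)
qed

lemma steiner_integral_singleton:
  fixes x :: "'a::euclidean_space"
  shows "steiner_integral {x} = x /\<^sub>R real DIM('a)"
  by (simp add: steiner_integral_def integral_sphere_measure_inner_scaleR)

section \<open>The unitary group\<close>

definition hermitian :: "complex^'n \<Rightarrow> complex^'n \<Rightarrow> complex" where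
  "hermitian x y = (\<Sum>i\<in>UNIV. x $ i * cnj (y $ i))"

lemma inner_eq_Re_hermitian: "x \<bullet> y = Re (hermitian x y)"
  by (simp add: hermitian_def inner_vec_def inner_complex_def)

lemma norm_axis: "norm (axis k x :: 'a::real_inner ^ 'n) = norm x"
  by (simp add: norm_eq_sqrt_inner inner_axis_axis)

lemma scaleR_eq_scalar_mult: "r *\<^sub>R x = complex_of_real r *s (x :: complex^'n)"
  by (simp add: vec_eq_iff scaleR_conv_of_real[where 'a = complex])

lemma hermitian_self: "hermitian x x = of_real ((norm x)\<^sup>2)"
proof (rule complex_eqI)
  show "Re (hermitian x x) = Re (of_real ((norm x)\<^sup>2))"
    by (simp add: dot_square_norm flip: inner_eq_Re_hermitian)
  show "Im (hermitian x x) = Im (of_real ((norm x)\<^sup>2))"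
    by (simp add: hermitian_def)
qed

lemma hermitian_add_left: "hermitian (x + y) z = hermitian x z + hermitian y z"
  and hermitian_diff_left: "hermitian (x - y) z = hermitian x z - hermitian y z"
  and hermitian_diff_right: "hermitian z (x - y) = hermitian z x - hermitian z y"
  and hermitian_scale_left: "hermitian (c *s x) z = c * hermitian x z"
  by (simp_all add: hermitian_def algebra_simps sum.distrib sum_subtractf sum_distrib_left)

lemma hermitian_commute: "hermitian y x = cnj (hermitian x y)"
  by (simp add: hermitian_def mult.commute)

lemma hermitian_adjoint: "hermitian (A *v x) y = hermitian x (adjoint_matrix A *v y)"
proof -
  have "hermitian (A *v x) y = (\<Sum>i\<in>UNIV. \<Sum>j\<in>UNIV. A $ i $ j * x $ j * cnj (y $ i))"
    by (simp add: hermitian_def matrix_vector_mult_def sum_distrib_right)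
  also have "\<dots> = (\<Sum>j\<in>UNIV. \<Sum>i\<in>UNIV. A $ i $ j * x $ j * cnj (y $ i))" by (rule sum.swap)
  also have "\<dots> = hermitian x (adjoint_matrix A *v y)"
    by (simp add: hermitian_def matrix_vector_mult_def adjoint_matrix_def sum_distrib_left mult_ac)
  finally show ?thesis .
qed

lemma linear_matrix_vector_mult_complex: "linear (\<lambda>x. (A :: complex^'n^'m) *v x)"
  by (rule linearI)
     (simp_all add: vec_eq_iff matrix_vector_mult_def distrib_left sum.distrib scaleR_sum_right)

lemma orthogonal_transformation_unitary:
  assumes "A \<in> unitary_group"
  shows "orthogonal_transformation (\<lambda>x. A *v x)"
proof -
  have "(A *v x) \<bullet> (A *v y) = x \<bullet> y" for x y
    using assms by (simp add: inner_eq_Re_hermitian hermitian_adjoint matrix_vector_mul_assoc unitary_group_def)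
  then show ?thesis
    by (simp add: orthogonal_transformation_def linear_matrix_vector_mult_complex)
qed

lemma mat_scalar_mult_vec: "(mat c :: complex^'n^'n) *v x = c *s x"
proof -
  have "(\<Sum>j\<in>UNIV. (if i = j then c else 0) * x $ j) = (\<Sum>j\<in>UNIV. if i = j then c * x $ j else 0)" for i
    by (rule sum.cong) auto
  then show ?thesis
    by (simp add: mat_def matrix_vector_mult_def vec_eq_iff)
qed

lemma mat_scalar_in_unitary_group:
  assumes "cmod c = 1"
  shows "(mat c :: complex^'n^'n) \<in> unitary_group"
proof -
  have "adjoint_matrix (mat c :: complex^'n^'n) = mat (cnj c)"
    by (simp add: adjoint_matrix_def mat_def vec_eq_iff)
  moreover have "mat a ** mat b = (mat (a * b) :: complex^'n^'n)" for a b
    by (simp add: matrix_eq mat_scalar_mult_vec vector_smult_assoc flip: matrix_vector_mul_assoc)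
  ultimately show ?thesis
    using assms complex_norm_square[of c] by (simp add: unitary_group_def mult.commute)
qed

text \<open>The reflection in the complex hyperplane orthogonal to \<open>y\<close>.\<close>

definition unitary_reflection :: "complex^'n \<Rightarrow> complex^'n^'n" where
  "unitary_reflection y =
     (\<chi> i j. (if i = j then 1 else 0) - 2 * y $ i * cnj (y $ j) / hermitian y y)"

lemma unitary_reflection_mult_vec:
  "unitary_reflection y *v x = x - (2 * hermitian x y / hermitian y y) *s y"
  unfolding vec_eq_iff
proof
  fix i
  define c where "c = 2 * y $ i / hermitian y y"
  have "(unitary_reflection y *v x) $ i
      = (\<Sum>j\<in>UNIV. ((if i = j then 1 else 0) - 2 * y $ i * cnj (y $ j) / hermitian y y) * x $ j)"
    by (simp add: unitary_reflection_def matrix_vector_mult_def)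
  also have "\<dots> = (\<Sum>j\<in>UNIV. (if i = j then x $ j else 0) - c * (x $ j * cnj (y $ j)))"
    by (rule sum.cong) (simp_all add: c_def algebra_simps)
  also have "\<dots> = x $ i - c * hermitian x y"
    unfolding hermitian_def[of x y] sum_distrib_left sum_subtractf by simp
  finally show "(unitary_reflection y *v x) $ i = (x - (2 * hermitian x y / hermitian y y) *s y) $ i"
    by (simp add: c_def mult_ac)
qed

lemma unitary_reflection_in_unitary_group:
  assumes "y \<noteq> 0"
  shows "unitary_reflection y \<in> unitary_group"
proof -
  have h: "hermitian y y \<noteq> 0" using assms by (simp add: hermitian_self)
  have "cnj (hermitian y y) = hermitian y y" by (simp add: hermitian_self)
  then have "adjoint_matrix (unitary_reflection y) = unitary_reflection y"
    by (simp add: adjoint_matrix_def unitary_reflection_def vec_eq_iff mult_ac)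
  moreover have "unitary_reflection y ** unitary_reflection y = mat 1"
  proof -
    have "unitary_reflection y *v (unitary_reflection y *v x) = x" for x
    proof -
      have "hermitian (unitary_reflection y *v x) y = - hermitian x y"
        using h by (simp add: unitary_reflection_mult_vec hermitian_diff_left hermitian_scale_left)
      then have "unitary_reflection y *v (unitary_reflection y *v x)
          = (x - (2 * hermitian x y / hermitian y y) *s y) - (2 * (- hermitian x y) / hermitian y y) *s y"
        by (simp only: unitary_reflection_mult_vec)
      then show ?thesis by (simp add: vec_eq_iff)
    qed
    then show ?thesis
      by (simp add: matrix_eq matrix_vector_mul_assoc[symmetric])
  qed
  ultimately show ?thesis by (simp add: unitary_group_def)
qed

text \<open>Multiplying \<open>v\<close> by a phase \<open>c\<close> makes the hermitian product with \<open>w\<close> real, and then the reflection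
  along \<open>c v - w\<close> exchanges \<open>c v\<close> and \<open>w\<close>.\<close>

lemma unitary_group_transitive:
  fixes v w :: "complex^'n"
  assumes vw: "norm v = norm w"
  obtains A where "A \<in> unitary_group" "A *v v = w"
proof -
  define c where "c = (if hermitian v w = 0 then 1 else cnj (sgn (hermitian v w)))"
  have c: "cmod c = 1" by (simp add: c_def norm_sgn)
  have "c * hermitian v w = of_real (cmod (hermitian v w))"
    by (simp add: c_def sgn_eq complex_norm_square[symmetric] power2_eq_square field_simps)
  define v' where "v' = c *s v"
  have real: "hermitian v' w = of_real (cmod (hermitian v w))"
    unfolding v'_def hermitian_scale_left by fact
  note M = mat_scalar_in_unitary_group[OF c, where 'n = 'n]
  have v': "mat c *v v = v'" by (simp add: v'_def mat_scalar_mult_vec)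
  have n: "norm v' = norm w"
    using orthogonal_transformation_norm[OF orthogonal_transformation_unitary[OF M], of v] v' vw by simp
  show thesis
  proof (cases "v' = w")
    case True
    with M v' that show thesis by blast
  next
    case False
    define y where "y = v' - w"
    have y: "y \<noteq> 0" using False by (simp add: y_def)
    then have h: "hermitian y y \<noteq> 0" by (simp add: hermitian_self)
    have "hermitian w v' = hermitian v' w" using hermitian_commute[of w v'] by (simp add: real)
    moreover have "hermitian v' v' = hermitian w w" by (simp add: hermitian_self n)
    ultimately have "2 * hermitian v' y = hermitian y y"
      by (simp only: y_def hermitian_diff_left hermitian_diff_right) simp
    then have "unitary_reflection y *v v' = w"
      using h by (simp add: unitary_reflection_mult_vec y_def)
    then have "(unitary_reflection y ** mat c) *v v = w"
      by (simp add: v' flip: matrix_vector_mul_assoc)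
    moreover have "unitary_reflection y ** mat c \<in> unitary_group"
    proof -
      have U: "unitary_reflection y \<in> unitary_group" by (rule unitary_reflection_in_unitary_group[OF y])
      have adj: "adjoint_matrix (A ** B) = adjoint_matrix B ** adjoint_matrix A" for A B :: "complex^'n^'n"
        by (simp add: adjoint_matrix_def matrix_matrix_mult_def vec_eq_iff mult.commute)
      have "A ** B \<in> unitary_group" if "A \<in> unitary_group" "B \<in> unitary_group" for A B :: "complex^'n^'n"
      proof -
        have "adjoint_matrix (A ** B) ** (A ** B) = adjoint_matrix B ** (adjoint_matrix A ** A) ** B"
          "(A ** B) ** adjoint_matrix (A ** B) = A ** (B ** adjoint_matrix B) ** adjoint_matrix A"
          by (simp_all only: adj matrix_mul_assoc)
        then show ?thesis using that by (simp add: unitary_group_def)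
      qed
      then show ?thesis using U M by blast
    qed
    ultimately show thesis using that by blast
  qed
qed

lemma image_cap_body:
  fixes T :: "'a::euclidean_space \<Rightarrow> 'a"
  assumes T: "orthogonal_transformation T"
  shows "T ` cap_body \<epsilon> w = cap_body \<epsilon> (T w)"
proof -
  have surj: "surj T" using T by (rule orthogonal_transformation_surj)
  have iff: "T x \<in> cap_body \<epsilon> (T w) \<longleftrightarrow> x \<in> cap_body \<epsilon> w" for x
  proof -
    have "T x \<in> cap_body \<epsilon> (T w) \<longleftrightarrow>
        (\<forall>v. T v \<bullet> T x \<le> max ((2 *\<^sub>R T w) \<bullet> T v) ((1 + (norm (T w))\<^sup>2 - \<epsilon>\<^sup>2) * norm (T v)))"
      unfolding cap_body_def body_of_support_def mem_Collect_eq by (metis surj surjD)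
    then show ?thesis
      using T by (simp add: cap_body_def body_of_support_def orthogonal_transformation_def
          orthogonal_transformation_norm[OF T])
  qed
  show ?thesis
  proof (intro equalityI subsetI)
    fix y assume y: "y \<in> cap_body \<epsilon> (T w)"
    obtain x where "y = T x" using surj by (metis surjD)
    with y iff show "y \<in> T ` cap_body \<epsilon> w" by blast
  qed (use iff in blast)
qed

section \<open>Unitarily equivariant maps\<close>

locale unitary_equivariant_map = continuous_additive_map f
  for f :: "(complex^'n) set \<Rightarrow> complex^'n" +
  assumes equivariant: "\<And>g K. g \<in> unitary_affine_group \<Longrightarrow> K \<in> convex_bodies \<Longrightarrow> f (g ` K) = g (f K)"
begin

lemma map_unitary:
  assumes "A \<in> unitary_group" "K \<in> convex_bodies"
  shows "f ((\<lambda>x. A *v x) ` K) = A *v f K"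
proof -
  have "(\<lambda>x. A *v x) \<in> unitary_affine_group"
    using assms(1) unfolding unitary_affine_group_def
    by (intro CollectI exI[of _ A] exI[of _ "0 :: complex^'n"]) simp
  then show ?thesis using equivariant assms(2) by blast
qed

lemma map_singleton: "f {x} = x"
proof -
  have "(\<lambda>y. mat 1 *v y + x) \<in> unitary_affine_group"
    using mat_scalar_in_unitary_group[of 1, where 'n = 'n] unfolding unitary_affine_group_def by force
  from equivariant[OF this, of "{0}"] show ?thesis by (simp add: map_zero)
qed

lemma map_symmetric:
  assumes K: "K \<in> convex_bodies" and sym: "uminus ` K = K"
  shows "f K = 0"
proof -
  have neg: "(mat (- 1) :: complex^'n^'n) *v x = - x" for x by (simp add: mat_scalar_mult_vec vec_eq_iff)
  have "f ((\<lambda>x. mat (- 1) *v x) ` K) = mat (- 1) *v f K"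
    by (intro map_unitary K mat_scalar_in_unitary_group) simp
  then have "f K = - f K" by (simp add: neg sym)
  then show ?thesis by (simp add: vec_eq_iff)
qed

lemma map_cball: "0 \<le> r \<Longrightarrow> f (cball 0 r) = 0"
  by (rule map_symmetric)
     (simp_all add: image_orthogonal_transformation_cball orthogonal_transformation_def linear_uminus)

text \<open>If the image of the cap body had a nonzero component \<open>y'\<close> orthogonal to \<open>w\<close>, then the reflection
  along \<open>y'\<close> would preserve the cap body but change its image.\<close>

lemma map_cap_body_multiple:
  assumes e: "0 < \<epsilon>" "\<epsilon> < 1"
  obtains \<alpha> where "f (cap_body \<epsilon> w) = \<alpha> *s w"
proof (cases "w = 0")
  case True
  have "orthogonal_transformation (uminus :: complex^'n \<Rightarrow> complex^'n)"
    by (auto simp: orthogonal_transformation_def linear_uminus)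
  from image_cap_body[OF this, of \<epsilon> 0]
  have "f (cap_body \<epsilon> w) = 0"
    using True by (intro map_symmetric cap_body_in_convex_bodies e) simp
  then show thesis using that[of 0] by simp
next
  case False
  define y where "y = f (cap_body \<epsilon> w)"
  define a where "a = hermitian y w / hermitian w w"
  define y' where "y' = y - a *s w"
  have yw: "hermitian y' w = 0"
    using False by (simp add: y'_def a_def hermitian_diff_left hermitian_scale_left hermitian_self)
  have "y' = 0"
  proof (rule ccontr)
    assume y': "y' \<noteq> 0"
    define A where "A = unitary_reflection y'"
    have A: "A \<in> unitary_group" unfolding A_def by (rule unitary_reflection_in_unitary_group[OF y'])
    have Aw: "A *v w = w"
      using yw hermitian_commute[of y' w] by (simp add: A_def unitary_reflection_mult_vec)
    have h: "hermitian y' y' \<noteq> 0" using y' by (simp add: hermitian_self)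
    have "y = y' + a *s w" by (simp add: y'_def)
    then have "hermitian y y' = hermitian y' y'"
      using yw hermitian_commute[of y' w] by (simp add: hermitian_add_left hermitian_scale_left)
    then have "A *v y = y - 2 *s y'" using h by (simp add: A_def unitary_reflection_mult_vec)
    moreover have "A *v y = y"
      using map_unitary[OF A cap_body_in_convex_bodies[OF e, of w]]
        image_cap_body[OF orthogonal_transformation_unitary[OF A], of \<epsilon> w]
      by (simp add: y_def Aw)
    ultimately show False using y' by (simp add: vec_eq_iff)
  qed
  then show thesis using that[of a] by (simp add: y'_def y_def)
qed

text \<open>By transitivity of the unitary group the factor can be read off at the vector of the same length on
  a coordinate axis, which exhibits it as a continuous function of the length.\<close>

lemma map_cap_body:
  assumes e: "0 < \<epsilon>" "\<epsilon> < 1"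
  shows "f (cap_body \<epsilon> w) = (f (cap_body \<epsilon> (axis k (of_real (norm w)))) $ k) *s sgn w"
proof (cases "w = 0")
  case True
  then show ?thesis using map_cap_body_multiple[OF e, of w] by (metis sgn_zero vector_smult_rzero)
next
  case False
  define v :: "complex^'n" where "v = axis k (of_real (norm w))"
  have "norm v = norm w" by (simp add: v_def norm_axis)
  then obtain A where A: "A \<in> unitary_group" "A *v v = w" by (rule unitary_group_transitive)
  obtain \<alpha> where \<alpha>: "f (cap_body \<epsilon> v) = \<alpha> *s v" by (rule map_cap_body_multiple[OF e])
  have "f (cap_body \<epsilon> w) = A *v (\<alpha> *s v)"
    using map_unitary[OF A(1) cap_body_in_convex_bodies[OF e, of v]]
      image_cap_body[OF orthogonal_transformation_unitary[OF A(1)], of \<epsilon> v]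
    by (simp add: A(2) \<alpha>)
  also have "\<dots> = \<alpha> *s w" by (simp add: vector_scalar_commute A(2))
  also have "\<dots> = (\<alpha> *s v) $ k *s sgn w"
    using False by (simp add: v_def sgn_div_norm vec_eq_iff scaleR_eq_scalar_mult)
  finally show ?thesis by (simp add: \<alpha> flip: v_def)
qed

text \<open>Homogeneity \<open>h\<^sub>K(w) = |w| h\<^sub>K(sgn w)\<close> splits the integrand of \<open>map_smoothed_body\<close> into a radial
  factor \<open>\<kappa>\<close> and a function of the direction.  The radial factor is complex, and its real and
  imaginary parts are integrated separately.\<close>

lemma map_smoothed_body_steiner:
  assumes e: "0 < \<epsilon>" "\<epsilon> < 1"
  obtains C where "\<And>K. K \<in> convex_bodies \<Longrightarrow> 0 \<in> K \<Longrightarrow> f (smoothed_body \<epsilon> K) = C *s steiner_integral K"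
proof -
  obtain k :: 'n where True by simp
  define Z where "Z = kernel_mass TYPE(complex^'n) \<epsilon>"
  define \<kappa> where "\<kappa> r = of_real (r / Z) * f (cap_body \<epsilon> (axis k (of_real r))) $ k" for r
  have cont: "continuous_on {0..2} \<kappa>"
  proof -
    have "continuous_on (cball 0 2) (\<lambda>w. f (cap_body \<epsilon> w))"
      by (rule continuous_on_comp_body_family[OF cap_body_in_convex_bodies[OF e] cap_body_lipschitz[OF e]])
    moreover have "continuous_on {0..2::real} (\<lambda>r. axis k (complex_of_real r))"
      unfolding axis_def
    proof (rule continuous_on_vec_lambda)
      show "continuous_on {0..2} (\<lambda>r. if i = k then complex_of_real r else 0)" for i
        by (cases "i = k") (auto intro!: continuous_intros)
    qed
    ultimately have "continuous_on {0..2} (\<lambda>r. f (cap_body \<epsilon> (axis k (complex_of_real r))))"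
      by (rule continuous_on_compose2) (auto simp: norm_axis)
    then show ?thesis
      unfolding \<kappa>_def divide_inverse by (intro continuous_intros)
  qed
  have imag: "bounded_linear (\<lambda>x::complex^'n. \<i> *s x)"
    unfolding linear_conv_bounded_linear[symmetric]
    by (rule linearI) (simp_all add: vec_eq_iff distrib_left)
  define m1 where "m1 = (\<integral>w. indicator (cball (0::complex^'n) 2) w *\<^sub>R Re (\<kappa> (norm w)) \<partial>lborel)"
  define m2 where "m2 = (\<integral>w. indicator (cball (0::complex^'n) 2) w *\<^sub>R Im (\<kappa> (norm w)) \<partial>lborel)"
  have "f (smoothed_body \<epsilon> K) = Complex m1 m2 *s steiner_integral K" if K: "K \<in> convex_bodies" "0 \<in> K" for K
  proof -
    define G where "G u = support_function K u *\<^sub>R u" for u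
    have G: "continuous_on A G" for A
      unfolding G_def
      by (intro continuous_intros continuous_on_sublinear sublinear_support_function K)
    have G': "continuous_on A (\<lambda>u. \<i> *s G u)" for A
      by (rule bounded_linear.continuous_on[OF imag G])
    note R = continuous_on_Re[OF cont] and I = continuous_on_Im[OF cont]
    have hom: "support_function K w = norm w * support_function K (sgn w)" for w
    proof -
      have "support_function K (norm w *\<^sub>R sgn w) = norm w * support_function K (sgn w)"
        using sublinear_support_function[OF K(1)] by (simp add: sublinear_def)
      then show ?thesis by (cases "w = 0") (simp_all add: sgn_div_norm)
    qed
    have eq: "(support_function K w / Z) *\<^sub>R f (cap_body \<epsilon> w)
        = Re (\<kappa> (norm w)) *\<^sub>R G (sgn w) + Im (\<kappa> (norm w)) *\<^sub>R (\<i> *s G (sgn w))" for w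
    proof -
      have "(support_function K w / Z) *\<^sub>R f (cap_body \<epsilon> w) = \<kappa> (norm w) *s G (sgn w)"
        by (subst map_cap_body[OF e, of _ k], subst hom)
           (simp add: \<kappa>_def G_def vec_eq_iff scaleR_eq_scalar_mult)
      also have "\<dots> = Re (\<kappa> (norm w)) *\<^sub>R G (sgn w) + Im (\<kappa> (norm w)) *\<^sub>R (\<i> *s G (sgn w))"
        by (subst (1) complex_eq[of "\<kappa> (norm w)"])
           (simp add: vec_eq_iff scaleR_eq_scalar_mult algebra_simps)
      finally show ?thesis .
    qed
    have "f (smoothed_body \<epsilon> K) = (\<integral>w. indicator (cball 0 2) w *\<^sub>R Re (\<kappa> (norm w)) *\<^sub>R G (sgn w)
        + indicator (cball 0 2) w *\<^sub>R Im (\<kappa> (norm w)) *\<^sub>R (\<i> *s G (sgn w)) \<partial>lborel)"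
      using map_smoothed_body[OF _ K e] map_cball
      unfolding Z_def[symmetric] eq scaleR_add_right by blast
    also have "\<dots> = (\<integral>w. indicator (cball 0 2) w *\<^sub>R Re (\<kappa> (norm w)) *\<^sub>R G (sgn w) \<partial>lborel)
        + (\<integral>w. indicator (cball 0 2) w *\<^sub>R Im (\<kappa> (norm w)) *\<^sub>R (\<i> *s G (sgn w)) \<partial>lborel)"
      by (intro Bochner_Integration.integral_add integrable_radial R I G
          integrable_radial[where G = "\<lambda>u. \<i> *s G u"] G')
    also have "\<dots> = m1 *\<^sub>R steiner_integral K + m2 *\<^sub>R (\<integral>u. \<i> *s G u \<partial>sphere_measure)"
      using integral_radial[OF _ R G] integral_radial[OF _ I G']
      by (simp add: m1_def m2_def steiner_integral_def G_def)
    also have "(\<integral>u. \<i> *s G u \<partial>sphere_measure) = \<i> *s steiner_integral K"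
      unfolding steiner_integral_def G_def[symmetric]
      by (rule integral_bounded_linear[OF imag integrable_sphere_measure[OF G]])
    also have "m1 *\<^sub>R steiner_integral K + m2 *\<^sub>R (\<i> *s steiner_integral K)
        = Complex m1 m2 *s steiner_integral K"
      by (simp add: vec_eq_iff scaleR_eq_scalar_mult Complex_eq algebra_simps)
    finally show ?thesis .
  qed
  then show thesis using that by blast
qed

lemma map_eq_steiner_point:
  assumes K: "K \<in> convex_bodies"
  shows "f K = steiner_point K"
proof -
  define e where "e i = 1 / real (i + 2)" for i
  have e: "0 < e i" "e i < 1" for i by (simp_all add: e_def)
  have e_lim: "e \<longlonglongrightarrow> 0"
    unfolding e_def using LIMSEQ_ignore_initial_segment[OF lim_1_over_n, of 2] by simp
  have "\<exists>C. \<forall>K. K \<in> convex_bodies \<longrightarrow> 0 \<in> K \<longrightarrow> f (smoothed_body (e i) K) = C *s steiner_integral K" for i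
    by (rule map_smoothed_body_steiner[OF e(1)[of i] e(2)[of i]]) blast
  then obtain C where C: "\<And>i K. K \<in> convex_bodies \<Longrightarrow> 0 \<in> K \<Longrightarrow>
      f (smoothed_body (e i) K) = C i *s steiner_integral K" by metis
  define d where "d = real DIM(complex^'n)"
  have d: "0 < d" by (simp add: d_def)
  obtain k :: 'n where True by simp
  define x :: "complex^'n" where "x = axis k 1"
  have x: "norm x = 1" "x $ k = 1" by (simp_all add: x_def)
  have lim: "(\<lambda>i. C i *s steiner_integral L) \<longlonglongrightarrow> f L" if "L \<in> convex_bodies" "0 \<in> L" for L
    using tendsto_smoothed_body[OF that(1) e(1) e_lim] that by (simp add: C)
  \<comment> \<open>The test body that determines the limit of \<open>C\<close> is the unit ball with centre \<open>x\<close>.\<close>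
  have "x + - x \<in> {x} + cball 0 1" using x(1) by (intro set_plus_intro) auto
  then have B: "{x} + cball 0 1 \<in> convex_bodies" "0 \<in> {x} + cball 0 1"
    by (simp_all add: convex_bodies_plus)
  have "steiner_integral ({x} + cball 0 1) = x /\<^sub>R d" "f ({x} + cball 0 1) = x"
    by (simp_all add: steiner_integral_plus steiner_integral_singleton steiner_integral_cball d_def
        additive map_singleton map_cball)
  then have "(\<lambda>i. (C i *s (x /\<^sub>R d)) $ k) \<longlonglongrightarrow> x $ k"
    using tendsto_vec_nth[OF lim[OF B], of k] by simp
  then have "(\<lambda>i. C i * of_real (1 / d)) \<longlonglongrightarrow> 1"
    by (simp add: x scaleR_eq_scalar_mult divide_inverse)
  from tendsto_mult_right[OF this, of "of_real d"] have C_lim: "C \<longlonglongrightarrow> of_real d"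
    using d by simp
  have "bounded K" using K by (simp add: convex_bodies_iff compact_imp_bounded)
  then obtain b where b: "\<And>x. x \<in> K \<Longrightarrow> norm x \<le> b" unfolding bounded_iff by blast
  define R where "R = max 0 b"
  have R: "0 \<le> R" "\<And>x. x \<in> K \<Longrightarrow> norm x \<le> R" using b by (auto simp: R_def le_max_iff_disj)
  define L where "L = K + cball 0 R"
  obtain y where y: "y \<in> K" using K by (auto simp: convex_bodies_iff)
  have "y + (- y) \<in> L"
    unfolding L_def using y R by (intro set_plus_intro) auto
  then have L: "L \<in> convex_bodies" "0 \<in> L"
    using K R by (simp_all add: L_def convex_bodies_plus)
  have fL: "f L = f K" and sL: "steiner_integral L = steiner_integral K"
    using K R by (simp_all add: L_def additive map_cball steiner_integral_plus steiner_integral_cball)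
  have "(\<lambda>i. C i *s steiner_integral K) \<longlonglongrightarrow> of_real d *s steiner_integral K"
    by (intro vec_tendstoI) (simp, intro tendsto_intros C_lim)
  then have "f K = of_real d *s steiner_integral K"
    using lim[OF L] LIMSEQ_unique unfolding fL sL by blast
  then show ?thesis
    by (simp add: steiner_point_eq d_def vec_eq_iff scaleR_eq_scalar_mult)
qed

end

theorem theorem3p13:
  fixes f :: "(complex^'n) set \<Rightarrow> complex^'n"
  assumes continuous: "continuous_map hausdorff.mtopology euclidean f"
    and additive: "\<And>K L. K \<in> convex_bodies \<Longrightarrow> L \<in> convex_bodies \<Longrightarrow> f (K + L) = f K + f L"
    and equivariant: "\<And>g K. g \<in> unitary_affine_group \<Longrightarrow> K \<in> convex_bodies \<Longrightarrow> f (g ` K) = g (f K)"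
  shows "\<forall>K\<in>convex_bodies. f K = steiner_point K"
proof -
  interpret unitary_equivariant_map f
    by unfold_locales (fact assms)+
  show ?thesis using map_eq_steiner_point by blast
qed

end
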